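(* Let $G$ and $\Gamma$ be countable groups and let $\Sigma$ be an ergodic ME coupling of $G$ with $\Gamma$. Let $\mathcal{G}$ be a family of subgroups of $\Gamma$ and suppose that $\Gamma$ is bi-exact relative to $\mathcal{G}$. Let $H$ be a subgroup of $G$. If the centralizer $Z_G(H)=\{g\in G \mid gh=hg \text{ for all } h\in H\}$ is non-amenable, then there exists $\Lambda\in\mathcal{G}$ such that $H\preceq_\Sigma\Lambda$.
   Context: All groups are countable and discrete. An ME coupling of $G$ with $\Gamma$ is a standard measure space $(\Sigma,\nu)$ with a measure preserving action of $G\times\Gamma$ for which there are measurable subsets $X,Y\subset\Sigma$ with $\Sigma=\bigsqcup_{\gamma\in\Gamma}\gamma X=\bigsqcup_{g\in G}gY$, $\nu(X)<\infty$ and $\nu(Y)<\infty$. It is ergodic if the $G\times\Gamma$-action is ergodic. For subgroups $H\subset G$, $\Lambda\subset\Gamma$, we write $H\preceq_\Sigma\Lambda$ ($H$ measurably embeds into $\Lambda$ in $\Sigma$) if there is a non-null $H\times\Lambda$-invariant measurable subset $\Omega\subset\Sigma$ such that a fundamental domain for the $\Lambda$-action on $\Omega$ has finite measure. A subset $\Gamma_1\subset\Gamma$ is small relative to $\mathcal{G}$ if $\Gamma_1\subset\bigcup_{i=1}^n s_i\Lambda_it_i$ for some finitely many $s_i,t_i\in\Gamma$, $\Lambda_i\in\mathcal{G}$. The group $\Gamma$ is bi-exact relative to $\mathcal{G}$ if there is a map $\mu:\Gamma\to\mathrm{Prob}(\Gamma)\subset\ell_1\Gamma$ such that for every $\epsilon>0$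 and $s,t\in\Gamma$ there is a subset $\Gamma_1\subset\Gamma$ small relative to $\mathcal{G}$ with $\|\mu(sxt)-s\mu(x)\|_1<\epsilon$ for all $x\in\Gamma\setminus\Gamma_1$. This is used interchangeably with the characterization recalled from Brown and Ozawa's book: the left-times-right translation action of $\Gamma\times\Gamma$ on the Gelfand spectrum of $\ell_\infty\Gamma/c_0(\Gamma;\mathcal{G})$ is topologically amenable, where $c_0(\Gamma;\mathcal{G})$ is the $C^*$-subalgebra of $\ell_\infty\Gamma$ generated by functions whose supports are small relative to $\mathcal{G}$. *)

theory Defs
  imports "HOL-Probability.Probability" "HOL-Algebra.Algebra"
begin

definition centralizer :: "('a, 'm) monoid_scheme \<Rightarrow> 'a set \<Rightarrow> 'a set"
  where "centralizer G H = {g \<in> carrier G. \<forall>h\<in>H. g \<otimes>\<^bsub>G\<^esub> h = h \<otimes>\<^bsub>G\<^esub> g}"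

(* Von Neumann's definition, for discrete groups. Values of m off Pow (carrier G) are irrelevant. *)
definition amenable :: "('a, 'm) monoid_scheme \<Rightarrow> bool"
  where "amenable G \<longleftrightarrow>
    (\<exists>m :: 'a set \<Rightarrow> real.
       m (carrier G) = 1 \<and>
       (\<forall>A \<subseteq> carrier G. 0 \<le> m A) \<and>
       (\<forall>A \<subseteq> carrier G. \<forall>B \<subseteq> carrier G. A \<inter> B = {} \<longrightarrow> m (A \<union> B) = m A + m B) \<and>
       (\<forall>g \<in> carrier G. \<forall>A \<subseteq> carrier G. m (g <#\<^bsub>G\<^esub> A) = m A))"

definition small_relative :: "('c, 'n) monoid_scheme \<Rightarrow> 'c set set \<Rightarrow> 'c set \<Rightarrow> bool"
  where "small_relative \<Gamma> \<G> A \<longleftrightarrow>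
    (\<exists>F. finite F \<and> F \<subseteq> carrier \<Gamma> \<times> \<G> \<times> carrier \<Gamma> \<and>
         A \<subseteq> (\<Union>(s, \<Lambda>, t) \<in> F. s <#\<^bsub>\<Gamma>\<^esub> \<Lambda> #>\<^bsub>\<Gamma>\<^esub> t))"

(* Prob(\<Gamma>) is the set of pmfs supported on carrier \<Gamma>; the translate s p is the push-forward
   of p under left multiplication by s. *)
definition bi_exact_relative :: "('c, 'n) monoid_scheme \<Rightarrow> 'c set set \<Rightarrow> bool"
  where "bi_exact_relative \<Gamma> \<G> \<longleftrightarrow>
    (\<exists>\<mu> :: 'c \<Rightarrow> 'c pmf.
       (\<forall>x \<in> carrier \<Gamma>. set_pmf (\<mu> x) \<subseteq> carrier \<Gamma>) \<and>
       (\<forall>\<epsilon> > 0. \<forall>s \<in> carrier \<Gamma>. \<forall>t \<in> carrier \<Gamma>.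
          \<exists>\<Gamma>\<^sub>1 \<subseteq> carrier \<Gamma>. small_relative \<Gamma> \<G> \<Gamma>\<^sub>1 \<and>
            (\<forall>x \<in> carrier \<Gamma> - \<Gamma>\<^sub>1.
               (\<Sum>\<^sub>\<infinity>y \<in> carrier \<Gamma>.
                  \<bar>pmf (\<mu> (s \<otimes>\<^bsub>\<Gamma>\<^esub> x \<otimes>\<^bsub>\<Gamma>\<^esub> t)) y
                   - pmf (map_pmf (\<lambda>z. s \<otimes>\<^bsub>\<Gamma>\<^esub> z) (\<mu> x)) y\<bar>) < \<epsilon>)))"

(* A sigma-finite Borel measure on a Polish space. *)
definition standard_measure_space :: "'x measure \<Rightarrow> bool"
  where "standard_measure_space M \<longleftrightarrow>
    (\<exists>T :: 'x topology. completely_metrizable_space T \<and> separable_space T \<and>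
         topspace T = space M \<and> sets M = sigma_sets (topspace T) {U. openin T U}) \<and>
    sigma_finite_measure M"

locale measure_preserving_action =
  group_action K "space M" \<phi>
  for K :: "('k, 'm) monoid_scheme" and M :: "'x measure" and \<phi> :: "'k \<Rightarrow> 'x \<Rightarrow> 'x" +
  assumes measurable_action: "k \<in> carrier K \<Longrightarrow> \<phi> k \<in> measurable M M"
    and preserves_measure: "k \<in> carrier K \<Longrightarrow> distr M M (\<phi> k) = M"

(* S is the set of acting group elements. Disjointness of the indexed family forces the
   action of S on \<Omega> to be free. *)
definition fundamental_domain ::
  "'x measure \<Rightarrow> 'k set \<Rightarrow> ('k \<Rightarrow> 'x \<Rightarrow> 'x) \<Rightarrow> 'x set \<Rightarrow> 'x set \<Rightarrow> bool"
  where "fundamental_domain M S act \<Omega> D \<longleftrightarrow>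
    D \<in> sets M \<and> disjoint_family_on (\<lambda>s. act s ` D) S \<and> (\<Union>s\<in>S. act s ` D) = \<Omega>"

(* The non-nullity assumption excludes the zero measure, for which every action would be
   an ergodic coupling. *)
locale ME_coupling =
  measure_preserving_action "G \<times>\<times> \<Gamma>" M \<phi>
  for G :: "('g, 'm) monoid_scheme" and \<Gamma> :: "('c, 'n) monoid_scheme"
    and M :: "'x measure" and \<phi> :: "'g \<times> 'c \<Rightarrow> 'x \<Rightarrow> 'x" +
  assumes standard: "standard_measure_space M"
    and nonnull: "emeasure M (space M) \<noteq> 0"
    and finite_domain_\<Gamma>: "\<exists>D. fundamental_domain M (carrier \<Gamma>) (\<lambda>\<gamma>. \<phi> (\<one>\<^bsub>G\<^esub>, \<gamma>)) (space M) D
          \<and> emeasure M D < \<infinity>"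
    and finite_domain_G: "\<exists>D. fundamental_domain M (carrier G) (\<lambda>g. \<phi> (g, \<one>\<^bsub>\<Gamma>\<^esub>)) (space M) D
          \<and> emeasure M D < \<infinity>"

locale ergodic_ME_coupling = ME_coupling +
  assumes ergodic: "A \<in> sets M \<Longrightarrow> (\<And>k. k \<in> carrier (G \<times>\<times> \<Gamma>) \<Longrightarrow> \<phi> k ` A = A) \<Longrightarrow>
    A \<in> null_sets M \<or> space M - A \<in> null_sets M"

definition measurably_embeds ::
  "('g, 'm) monoid_scheme \<Rightarrow> 'x measure \<Rightarrow> ('g \<times> 'c \<Rightarrow> 'x \<Rightarrow> 'x) \<Rightarrow> 'g set \<Rightarrow> 'c set \<Rightarrow> bool"
  where "measurably_embeds G M \<phi> H \<Lambda> \<longleftrightarrow>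
    (\<exists>\<Omega> \<in> sets M. emeasure M \<Omega> \<noteq> 0 \<and>
       (\<forall>h \<in> H. \<forall>l \<in> \<Lambda>. \<phi> (h, l) ` \<Omega> = \<Omega>) \<and>
       (\<exists>D. fundamental_domain M \<Lambda> (\<lambda>l. \<phi> (\<one>\<^bsub>G\<^esub>, l)) \<Omega> D \<and> emeasure M D < \<infinity>))"

end

theory Submission
  imports Defs
begin

text \<open>
  Suppose that \<open>H\<close> embeds into no member of \<open>\<G>\<close>. The claim is that the centralizer of \<open>H\<close> is amenable,
  and an invariant mean on it is produced from almost invariant integrable densities on \<open>\<Sigma>\<close>.

  Let \<open>D\<close> be a fundamental domain for \<open>\<Gamma>\<close> and let \<open>\<pi> : \<Sigma> \<rightarrow> \<Gamma>\<close> tell in which translate of \<open>D\<close> a point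
  lies. For \<open>k \<in> G\<close> the displacement \<open>(\<pi> x)\<^sup>-\<^sup>1 \<pi> (k x)\<close> depends only on the \<open>\<Gamma>\<close>-orbit of \<open>x\<close>; it is the
  cocycle of the coupling. If \<open>k \<in> H\<close> and \<open>g\<close> centralizes \<open>H\<close>, moving \<open>x\<close> by \<open>g\<close> replaces the displacement
  \<open>c\<close> under \<open>k\<close> by \<open>s c t\<close>, where \<open>s\<close> and \<open>t\<close> do not depend on \<open>k\<close> except through the point at which they
  are evaluated. The map \<open>\<mu>\<close> given by bi-exactness satisfies \<open>\<mu> (s c t) \<approx> s \<mu> c\<close> for \<open>c\<close> outside a small
  subset of \<open>\<Gamma>\<close>. So the density \<open>x \<mapsto> \<mu> c ((\<pi> x)\<^sup>-\<^sup>1)\<close> is almost invariant under \<open>g\<close> as soon as \<open>c\<close> rarely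
  lies in that small set (\<open>transported_density_shift\<close>). The group \<open>G\<close> acts on \<open>\<Sigma>\<close> with a fundamental
  domain, hence there is an equivariant map from \<open>\<Sigma>\<close> to the centralizer; it carries the densities to almost
  invariant means, and compactness yields an invariant one (\<open>amenable_of_almost_invariant_densities\<close>).

  It remains to find \<open>k \<in> H\<close> whose displacement rarely lies in a given small set. If there is none, then
  \<open>\<nu> (h D \<inter> \<Union>\<^sub>i s\<^sub>i \<Lambda>\<^sub>i t\<^sub>i D)\<close> is bounded below over all \<open>h \<in> H\<close>, for some finitely many \<open>\<Lambda>\<^sub>i \<in> \<G>\<close>. Read in the
  quotients \<open>\<Sigma> / \<Lambda>\<^sub>i\<close>, on which \<open>H\<close> acts, this says that translates of one set of finite measure keep
  meeting another. The vector of least norm in a suitable closed convex set of \<open>L\<^sup>2\<close> is then non-zero and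
  \<open>H\<close>-invariant, and one of its level sets is an \<open>H\<close>-invariant set of finite positive measure in some
  \<open>\<Sigma> / \<Lambda>\<^sub>i\<close> (\<open>invariant_set_of_recurrence\<close>). That is an embedding of \<open>H\<close> into \<open>\<Lambda>\<^sub>i\<close>
  (\<open>embeds_of_recurrence\<close>), contrary to the assumption.
\<close>

section \<open>Invariant sets from recurrence\<close>

text \<open>
  Completeness of \<open>L\<^sup>2\<close> along a rapidly Cauchy sequence: the increments are summable almost
  everywhere, the limit is taken pointwise, and Fatou's lemma carries the bounds over to the limit.
\<close>

lemma L2_geometric_Cauchy_limit:
  fixes f :: "nat \<Rightarrow> 'a \<Rightarrow> real"
  assumes f [measurable]: "\<And>n. f n \<in> borel_measurable M"
    and "0 \<le> C"
    and Cauchy: "\<And>m n. n \<le> m \<Longrightarrow> (\<integral>\<^sup>+x. ennreal ((f m x - f n x)\<^sup>2) \<partial>M) \<le> ennreal (C / 4 ^ n)"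
  obtains g where "g \<in> borel_measurable M"
    and "\<And>n. (\<integral>\<^sup>+x. ennreal ((g x - f n x)\<^sup>2) \<partial>M) \<le> ennreal (C / 4 ^ n)"
proof -
  \<comment> \<open>The weight 2^n turns square-summability into summability:
     a real number d satisfies |d| \<le> 2^n d^2 + 2^-n, and the bound C / 4^n beats the weight.\<close>
  define d where "d n x = f (Suc n) x - f n x" for n x
  have d_meas [measurable]: "d n \<in> borel_measurable M" for n
    unfolding d_def by measurable
  have "(\<integral>\<^sup>+x. (suminf (\<lambda>n. ennreal (2 ^ n * (d n x)\<^sup>2))) \<partial>M)
      = (suminf (\<lambda>n. \<integral>\<^sup>+x. ennreal (2 ^ n * (d n x)\<^sup>2) \<partial>M))"
    by (intro nn_integral_suminf) simp
  also have "\<dots> \<le> (suminf (\<lambda>n. ennreal (C * (1/2) ^ n)))"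
  proof (intro suminf_le allI)
    fix n
    have "(\<integral>\<^sup>+x. ennreal (2 ^ n * (d n x)\<^sup>2) \<partial>M)
        = ennreal (2 ^ n) * (\<integral>\<^sup>+x. ennreal ((d n x)\<^sup>2) \<partial>M)"
      by (simp add: ennreal_mult nn_integral_cmult)
    also have "\<dots> \<le> ennreal (2 ^ n) * ennreal (C / 4 ^ n)"
      using Cauchy[of n "Suc n"] by (intro mult_left_mono) (auto simp: d_def)
    also have "\<dots> = ennreal (C * (1/2) ^ n)"
    proof -
      have "(2::real) ^ n * (C / 4 ^ n) = C * (1/2) ^ n"
        by (simp add: power_divide field_simps flip: power_mult_distrib)
      then show ?thesis
        using \<open>0 \<le> C\<close> by (simp flip: ennreal_mult)
    qed
    finally show "(\<integral>\<^sup>+x. ennreal (2 ^ n * (d n x)\<^sup>2) \<partial>M) \<le> ennreal (C * (1/2) ^ n)" .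
  qed auto
  also have "\<dots> < \<infinity>"
    using \<open>0 \<le> C\<close> by (subst suminf_ennreal2) (auto intro!: summable_mult summable_geometric)
  finally have fin: "(\<integral>\<^sup>+x. (suminf (\<lambda>n. ennreal (2 ^ n * (d n x)\<^sup>2))) \<partial>M) < \<infinity>" .
  have "AE x in M. (suminf (\<lambda>n. ennreal (2 ^ n * (d n x)\<^sup>2))) \<noteq> \<infinity>"
  proof (rule nn_integral_PInf_AE)
    show "(\<lambda>x. suminf (\<lambda>n. ennreal (2 ^ n * (d n x)\<^sup>2))) \<in> borel_measurable M"
      by measurable
  qed (use fin in simp)
  then have conv: "AE x in M. convergent (\<lambda>n. f n x)"
  proof eventually_elim
    fix x assume "(suminf (\<lambda>n. ennreal (2 ^ n * (d n x)\<^sup>2))) \<noteq> \<infinity>"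
    then have s: "summable (\<lambda>n. 2 ^ n * (d n x)\<^sup>2)"
      by (rule summable_suminf_not_top[rotated, folded infinity_ennreal_def]) simp
    have "norm (d n x) \<le> 2 ^ n * (d n x)\<^sup>2 + (1/2) ^ n" for n
    proof -
      have "0 \<le> (2 ^ n * \<bar>d n x\<bar> - 1)\<^sup>2 + 2 ^ n * \<bar>d n x\<bar>"
        by simp
      then have "2 ^ n * \<bar>d n x\<bar> \<le> (2 ^ n * \<bar>d n x\<bar>)\<^sup>2 + 1"
        by (simp add: power2_eq_square algebra_simps)
      then show ?thesis
        by (simp add: field_simps power2_eq_square)
    qed
    then have "summable (\<lambda>n. d n x)"
      by (intro summable_comparison_test'[OF summable_add[OF s summable_geometric[of "1/2"]]]) auto
    then have "convergent (\<lambda>n. \<Sum>i<n. d i x)"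
      by (simp add: summable_iff_convergent)
    moreover have "(\<Sum>i<n. d i x) = f n x - f 0 x" for n
      unfolding d_def by (rule sum_lessThan_telescope)
    ultimately have "convergent (\<lambda>n. f n x - f 0 x)"
      by simp
    then show "convergent (\<lambda>n. f n x)"
      by (simp add: convergent_diff_const_right_iff)
  qed
  define g where "g x = lim (\<lambda>n. f n x)" for x
  have g [measurable]: "g \<in> borel_measurable M"
    unfolding g_def by measurable
  have "(\<integral>\<^sup>+x. ennreal ((g x - f n x)\<^sup>2) \<partial>M) \<le> ennreal (C / 4 ^ n)" for n
  proof -
    have "(\<integral>\<^sup>+x. ennreal ((g x - f n x)\<^sup>2) \<partial>M)
        = (\<integral>\<^sup>+x. liminf (\<lambda>m. ennreal ((f m x - f n x)\<^sup>2)) \<partial>M)"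
    proof (rule nn_integral_cong_AE)
      show "AE x in M. ennreal ((g x - f n x)\<^sup>2) = liminf (\<lambda>m. ennreal ((f m x - f n x)\<^sup>2))"
        using conv
      proof eventually_elim
        fix x assume "convergent (\<lambda>n. f n x)"
        then have "(\<lambda>m. f m x) \<longlonglongrightarrow> g x"
          by (simp add: convergent_LIMSEQ_iff g_def)
        then have "(\<lambda>m. ennreal ((f m x - f n x)\<^sup>2)) \<longlonglongrightarrow> ennreal ((g x - f n x)\<^sup>2)"
          by (intro tendsto_ennrealI tendsto_intros)
        then show "ennreal ((g x - f n x)\<^sup>2) = liminf (\<lambda>m. ennreal ((f m x - f n x)\<^sup>2))"
          by (intro lim_imp_Liminf[symmetric]) auto
      qed
    qed
    also have "\<dots> \<le> liminf (\<lambda>m. \<integral>\<^sup>+x. ennreal ((f m x - f n x)\<^sup>2) \<partial>M)"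
      by (intro nn_integral_liminf) simp
    also have "\<dots> \<le> liminf (\<lambda>m::nat. ennreal (C / 4 ^ n))"
      using Cauchy by (intro Liminf_mono eventually_sequentiallyI[of n]) auto
    also have "\<dots> = ennreal (C / 4 ^ n)"
      by (simp add: Liminf_const)
    finally show ?thesis .
  qed
  with g that show ?thesis by blast
qed

text \<open>
  A mean ergodic argument. The square-integrable functions \<open>f\<close> with
  \<open>\<delta> \<le> \<integral> (f \<circ> T k) 1\<^sub>E\<close> for all \<open>k\<close> form a closed convex set that is invariant under the action and
  contains the indicator of \<open>A\<close> by recurrence. By the parallelogram law a sequence in it that minimizes
  the norm converges, and its members are almost fixed by the action, so the limit is invariant. The limit
  is not zero, since the constraint keeps norms away from zero. A level set of its square has finite
  positive measure and is invariant up to null sets; intersecting its countably many translates makes it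
  strictly invariant.
\<close>

lemma invariant_set_of_recurrence:
  fixes K (structure) and T :: "'k \<Rightarrow> 'a \<Rightarrow> 'a"
  assumes "group K" and countable: "countable (carrier K)"
    and T [measurable]: "\<And>k. k \<in> carrier K \<Longrightarrow> T k \<in> measurable M M"
    and distr: "\<And>k. k \<in> carrier K \<Longrightarrow> distr M M (T k) = M"
    and T_mult: "\<And>h k x. h \<in> carrier K \<Longrightarrow> k \<in> carrier K \<Longrightarrow> x \<in> space M \<Longrightarrow> T (h \<otimes> k) x = T h (T k x)"
    and T_one: "\<And>x. x \<in> space M \<Longrightarrow> T \<one> x = x"
    and A [measurable]: "A \<in> sets M" "emeasure M A < \<infinity>"
    and E [measurable]: "E \<in> sets M" "emeasure M E < \<infinity>"
    and "0 < \<delta>"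
    and recurrent: "\<And>k. k \<in> carrier K \<Longrightarrow> \<delta> \<le> measure M ({x \<in> space M. T k x \<in> A} \<inter> E)"
  obtains B where "B \<in> sets M" "0 < emeasure M B" "emeasure M B < \<infinity>"
    and "\<And>k x. k \<in> carrier K \<Longrightarrow> x \<in> space M \<Longrightarrow> T k x \<in> B \<longleftrightarrow> x \<in> B"
proof -
  interpret group K by fact
  define q where "q f = (\<integral>x. (f x)\<^sup>2 \<partial>M)" for f :: "'a \<Rightarrow> real"
  define C where "C = {f \<in> borel_measurable M. integrable M (\<lambda>x. (f x)\<^sup>2) \<and>
    (\<forall>k\<in>carrier K. \<delta> \<le> (\<integral>x. f (T k x) * indicator E x \<partial>M))}"
  have T_space: "T k x \<in> space M" if "k \<in> carrier K" "x \<in> space M" for k x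
    using measurable_space[OF T[OF that(1)] that(2)] .
  have C_meas: "f \<in> borel_measurable M" if "f \<in> C" for f
    using that by (auto simp: C_def)
  have C_sq: "integrable M (\<lambda>x. (f x)\<^sup>2)" if "f \<in> C" for f
    using that by (auto simp: C_def)
  have comp_sq: "integrable M (\<lambda>x. (f (T k x))\<^sup>2)"
    and comp_int: "(\<integral>x. (f (T k x))\<^sup>2 \<partial>M) = (\<integral>x. (f x)\<^sup>2 \<partial>M)"
    if [measurable]: "f \<in> borel_measurable M" and i: "integrable M (\<lambda>x. (f x)\<^sup>2)"
      and k: "k \<in> carrier K" for f :: "'a \<Rightarrow> real" and k
  proof -
    note [measurable] = T[OF k]
    have "integrable (distr M M (T k)) (\<lambda>x. (f x)\<^sup>2)"
      using i distr[OF k] by simp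
    then show "integrable M (\<lambda>x. (f (T k x))\<^sup>2)"
      by (subst (asm) integrable_distr_eq) auto
    have "(\<integral>x. (f x)\<^sup>2 \<partial>distr M M (T k)) = (\<integral>x. (f (T k x))\<^sup>2 \<partial>M)"
      by (intro integral_distr) auto
    then show "(\<integral>x. (f (T k x))\<^sup>2 \<partial>M) = (\<integral>x. (f x)\<^sup>2 \<partial>M)"
      using distr[OF k] by simp
  qed
  have prod_int: "integrable M (\<lambda>x. f x * g x)"
    if [measurable]: "f \<in> borel_measurable M" "g \<in> borel_measurable M"
      and i: "integrable M (\<lambda>x. (f x)\<^sup>2)" "integrable M (\<lambda>x. (g x)\<^sup>2)" for f g :: "'a \<Rightarrow> real"
  proof (rule Bochner_Integration.integrable_bound[OF Bochner_Integration.integrable_add[OF i]])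
    have "\<bar>f x * g x\<bar> \<le> (f x)\<^sup>2 + (g x)\<^sup>2" for x
    proof -
      have "0 \<le> (\<bar>f x\<bar> - \<bar>g x\<bar>)\<^sup>2" by simp
      then have "2 * \<bar>f x * g x\<bar> \<le> (f x)\<^sup>2 + (g x)\<^sup>2"
        by (simp add: power2_diff abs_mult)
      then show ?thesis by linarith
    qed
    then show "AE x in M. norm (f x * g x) \<le> norm ((f x)\<^sup>2 + (g x)\<^sup>2)"
      by auto
  qed simp
  have E_int: "integrable M (indicator E :: 'a \<Rightarrow> real)"
    using E by (intro integrable_real_indicator) auto
  have E_sq: "integrable M (\<lambda>x. (indicator E x :: real)\<^sup>2)"
  proof -
    have "(\<lambda>x. (indicator E x :: real)\<^sup>2) = indicator E"
      by (auto simp: indicator_def)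
    then show ?thesis using E_int by simp
  qed
  have C_translate: "(\<lambda>x. f (T k x)) \<in> C" if "f \<in> C" "k \<in> carrier K" for f k
  proof -
    note [measurable] = C_meas[OF \<open>f \<in> C\<close>] T[OF \<open>k \<in> carrier K\<close>]
    have "\<delta> \<le> (\<integral>x. f (T k (T h x)) * indicator E x \<partial>M)" if h: "h \<in> carrier K" for h
    proof -
      have "\<delta> \<le> (\<integral>x. f (T (k \<otimes> h) x) * indicator E x \<partial>M)"
        using \<open>f \<in> C\<close> \<open>k \<in> carrier K\<close> h by (auto simp: C_def)
      also have "\<dots> = (\<integral>x. f (T k (T h x)) * indicator E x \<partial>M)"
        using \<open>k \<in> carrier K\<close> h by (intro Bochner_Integration.integral_cong) (auto simp: T_mult)
      finally show ?thesis .
    qed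
    moreover have "integrable M (\<lambda>x. (f (T k x))\<^sup>2)"
      using that by (intro comp_sq) (auto intro: C_sq)
    ultimately show ?thesis
      by (auto simp: C_def)
  qed
  have C_mid: "(\<lambda>x. (f x + g x) / 2) \<in> C" if "f \<in> C" "g \<in> C" for f g
  proof -
    note [measurable] = C_meas[OF \<open>f \<in> C\<close>] C_meas[OF \<open>g \<in> C\<close>]
    have "integrable M (\<lambda>x. ((f x)\<^sup>2 + (g x)\<^sup>2 + 2 * (f x * g x)) / 4)"
      using that by (intro integrable_divide Bochner_Integration.integrable_add integrable_mult_right prod_int C_sq) auto
    moreover have "((f x)\<^sup>2 + (g x)\<^sup>2 + 2 * (f x * g x)) / 4 = ((f x + g x) / 2)\<^sup>2" for x
      by (simp add: power2_eq_square field_simps)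
    ultimately have "integrable M (\<lambda>x. ((f x + g x) / 2)\<^sup>2)"
      by simp
    moreover have "\<delta> \<le> (\<integral>x. (f (T k x) + g (T k x)) / 2 * indicator E x \<partial>M)" if k: "k \<in> carrier K" for k
    proof -
      note [measurable] = T[OF k]
      have i: "integrable M (\<lambda>x. f (T k x) * indicator E x)" "integrable M (\<lambda>x. g (T k x) * indicator E x)"
        using \<open>f \<in> C\<close> \<open>g \<in> C\<close> k by (auto intro!: prod_int C_sq C_translate E_sq)
      have "(\<integral>x. (f (T k x) + g (T k x)) / 2 * indicator E x \<partial>M)
          = (\<integral>x. (f (T k x) * indicator E x + g (T k x) * indicator E x) / 2 \<partial>M)"
        by (intro Bochner_Integration.integral_cong) (auto simp: field_simps)
      also have "\<dots> = ((\<integral>x. f (T k x) * indicator E x \<partial>M) + (\<integral>x. g (T k x) * indicator E x \<partial>M)) / 2"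
        using i by simp
      finally have eq: "(\<integral>x. (f (T k x) + g (T k x)) / 2 * indicator E x \<partial>M)
          = ((\<integral>x. f (T k x) * indicator E x \<partial>M) + (\<integral>x. g (T k x) * indicator E x \<partial>M)) / 2" .
      have "\<delta> \<le> (\<integral>x. f (T k x) * indicator E x \<partial>M)"
        using \<open>f \<in> C\<close> k unfolding C_def by blast
      moreover have "\<delta> \<le> (\<integral>x. g (T k x) * indicator E x \<partial>M)"
        using \<open>g \<in> C\<close> k unfolding C_def by blast
      ultimately have "\<delta> + \<delta> \<le> (\<integral>x. f (T k x) * indicator E x \<partial>M) + (\<integral>x. g (T k x) * indicator E x \<partial>M)"
        by (rule add_mono)
      then show ?thesis unfolding eq by simp
    qed
    ultimately show ?thesis
      by (auto simp: C_def)
  qed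
  \<comment> \<open>The squared distance from the constraint set C to the origin.\<close>
  define I where "I = Inf (q ` C)"
  have q_nonneg: "0 \<le> q f" for f
    by (auto simp: q_def)
  have bdd: "bdd_below (q ` C)"
    by (rule bdd_belowI[of _ 0]) (auto simp: q_nonneg)
  have I_le: "I \<le> q f" if "f \<in> C" for f
    unfolding I_def using bdd that by (auto intro: cINF_lower)
  have diff_int: "integrable M (\<lambda>x. (f x - g x)\<^sup>2)" if "f \<in> C" "g \<in> C" for f g
  proof -
    note [measurable] = C_meas[OF \<open>f \<in> C\<close>] C_meas[OF \<open>g \<in> C\<close>]
    have "integrable M (\<lambda>x. (f x)\<^sup>2 + (g x)\<^sup>2 - 2 * (f x * g x))"
      using that by (intro Bochner_Integration.integrable_diff Bochner_Integration.integrable_add integrable_mult_right prod_int C_sq) auto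
    moreover have "(f x)\<^sup>2 + (g x)\<^sup>2 - 2 * (f x * g x) = (f x - g x)\<^sup>2" for x
      by (simp add: power2_eq_square field_simps)
    ultimately show ?thesis by simp
  qed
  have parallelogram: "(\<integral>x. (f x - g x)\<^sup>2 \<partial>M) \<le> 2 * q f + 2 * q g - 4 * I" if "f \<in> C" "g \<in> C" for f g
  proof -
    note m = C_mid[OF that]
    have linear: "(\<integral>x. 2 * a x + 2 * b x - 4 * c x \<partial>M) = 2 * integral\<^sup>L M a + 2 * integral\<^sup>L M b - 4 * integral\<^sup>L M c"
      if "integrable M a" "integrable M b" "integrable M c" for a b c :: "'a \<Rightarrow> real"
      using that by simp
    have "(\<integral>x. (f x - g x)\<^sup>2 \<partial>M) = (\<integral>x. (2 * (f x)\<^sup>2 + 2 * (g x)\<^sup>2) - 4 * ((f x + g x) / 2)\<^sup>2 \<partial>M)"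
      by (intro Bochner_Integration.integral_cong) (auto simp: power2_eq_square field_simps)
    also have "\<dots> = 2 * q f + 2 * q g - 4 * q (\<lambda>x. (f x + g x) / 2)"
      unfolding q_def using C_sq[OF that(1)] C_sq[OF that(2)] C_sq[OF m]
      by (intro linear) auto
    also have "\<dots> \<le> 2 * q f + 2 * q g - 4 * I"
      using I_le[OF m] by simp
    finally show ?thesis .
  qed
  have "indicator A \<in> C"
  proof -
    have "(\<lambda>x. (indicator A x :: real)\<^sup>2) = indicator A"
      by (auto simp: indicator_def)
    moreover have "integrable M (indicator A :: 'a \<Rightarrow> real)"
      using A by (intro integrable_real_indicator) auto
    moreover have "\<delta> \<le> (\<integral>x. indicator A (T k x) * indicator E x \<partial>M)" if k: "k \<in> carrier K" for k
    proof -
      have "(\<integral>x. indicator A (T k x) * indicator E x \<partial>M)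
          = (\<integral>x. (indicator ({x \<in> space M. T k x \<in> A} \<inter> E) x :: real) \<partial>M)"
        by (intro Bochner_Integration.integral_cong) (auto simp: indicator_def)
      also have "\<dots> = measure M ({x \<in> space M. T k x \<in> A} \<inter> E)"
        using sets.sets_into_space[OF E(1)] by (simp add: Int_absorb2 le_infI2)
      finally show ?thesis using recurrent[OF k] by simp
    qed
    ultimately show ?thesis by (auto simp: C_def)
  qed
  then have C_ne: "C \<noteq> {}" by blast
  have "\<exists>f\<in>C. q f < I + 1 / 4 ^ n" for n :: nat
  proof -
    have "Inf (q ` C) < I + 1 / 4 ^ n" by (simp add: I_def)
    then show ?thesis
      using C_ne cInf_less_iff[of "q ` C"] bdd by auto
  qed
  then obtain f where f: "\<And>n. f n \<in> C" and q_f: "\<And>n. q (f n) < I + 1 / 4 ^ n"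
    by metis
  note [measurable] = C_meas[OF f]
  have Cauchy: "(\<integral>\<^sup>+x. ennreal ((f m x - f n x)\<^sup>2) \<partial>M) \<le> ennreal (4 / 4 ^ n)" if "n \<le> m" for m n
  proof -
    have "(1::real) / 4 ^ m \<le> 1 / 4 ^ n"
      using that by (intro divide_left_mono power_increasing) auto
    moreover have "(4::real) / 4 ^ n = 4 * (1 / 4 ^ n)" by simp
    ultimately have "(\<integral>x. (f m x - f n x)\<^sup>2 \<partial>M) \<le> 4 / 4 ^ n"
      using parallelogram[OF f[of m] f[of n]] q_f[of n] q_f[of m] by linarith
    then show ?thesis
      by (subst nn_integral_eq_integral) (auto intro: diff_int f)
  qed
  obtain g where g [measurable]: "g \<in> borel_measurable M"
    and lim: "\<And>n. (\<integral>\<^sup>+x. ennreal ((g x - f n x)\<^sup>2) \<partial>M) \<le> ennreal (4 / 4 ^ n)"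
    using L2_geometric_Cauchy_limit[of f M 4, OF _ _ Cauchy] by auto
  have zero_limit: "r = 0" if "\<And>n::nat. r \<le> ennreal (c / 4 ^ n)" for r and c :: real
  proof -
    have "(\<lambda>n. c / 4 ^ n) \<longlonglongrightarrow> 0"
      using LIMSEQ_divide_realpow_zero[of 4 c] by simp
    then have "(\<lambda>n. ennreal (c / 4 ^ n)) \<longlonglongrightarrow> ennreal 0"
      by (rule tendsto_ennrealI)
    then have "r \<le> ennreal 0"
      using that by (intro LIMSEQ_le_const) auto
    then show ?thesis by simp
  qed
  have invariant: "AE x in M. g (T k x) = g x" if k: "k \<in> carrier K" for k
  proof -
    note [measurable] = T[OF k]
    have "(\<integral>\<^sup>+x. ennreal ((g (T k x) - g x)\<^sup>2) \<partial>M) \<le> ennreal (36 / 4 ^ n)" for n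
    proof -
      let ?a = "\<lambda>x. g (T k x) - f n (T k x)" and ?b = "\<lambda>x. f n (T k x) - f n x" and ?c = "\<lambda>x. g x - f n x"
      have bound: "(a + b - c)\<^sup>2 \<le> 3 * (a\<^sup>2 + b\<^sup>2 + c\<^sup>2)" for a b c :: real
      proof -
        have "0 \<le> (a - b)\<^sup>2 + (a + c)\<^sup>2 + (b + c)\<^sup>2" by simp
        then show ?thesis by (simp add: power2_eq_square algebra_simps)
      qed
      have "(\<integral>\<^sup>+x. ennreal ((g (T k x) - g x)\<^sup>2) \<partial>M)
          \<le> (\<integral>\<^sup>+x. 3 * (ennreal ((?a x)\<^sup>2) + ennreal ((?b x)\<^sup>2) + ennreal ((?c x)\<^sup>2)) \<partial>M)"
      proof (intro nn_integral_mono)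
        fix x
        have "ennreal ((g (T k x) - g x)\<^sup>2) \<le> ennreal (3 * ((?a x)\<^sup>2 + (?b x)\<^sup>2 + (?c x)\<^sup>2))"
          using bound[of "?a x" "?b x" "?c x"] by (intro ennreal_leI) simp
        then show "ennreal ((g (T k x) - g x)\<^sup>2)
            \<le> 3 * (ennreal ((?a x)\<^sup>2) + ennreal ((?b x)\<^sup>2) + ennreal ((?c x)\<^sup>2))"
          by (simp add: ennreal_mult ennreal_plus)
      qed
      also have "\<dots> = 3 * ((\<integral>\<^sup>+x. ennreal ((?a x)\<^sup>2) \<partial>M) + (\<integral>\<^sup>+x. ennreal ((?b x)\<^sup>2) \<partial>M)
          + (\<integral>\<^sup>+x. ennreal ((?c x)\<^sup>2) \<partial>M))"
        by (simp add: nn_integral_cmult nn_integral_add)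
      also have "(\<integral>\<^sup>+x. ennreal ((?a x)\<^sup>2) \<partial>M) = (\<integral>\<^sup>+x. ennreal ((g x - f n x)\<^sup>2) \<partial>distr M M (T k))"
        by (subst nn_integral_distr) auto
      also have "\<dots> = (\<integral>\<^sup>+x. ennreal ((g x - f n x)\<^sup>2) \<partial>M)"
        by (simp only: distr[OF k])
      also have "3 * (\<dots> + (\<integral>\<^sup>+x. ennreal ((?b x)\<^sup>2) \<partial>M) + (\<integral>\<^sup>+x. ennreal ((?c x)\<^sup>2) \<partial>M))
          \<le> 3 * (ennreal (4 / 4 ^ n) + ennreal (4 / 4 ^ n) + ennreal (4 / 4 ^ n))"
      proof (intro mult_left_mono add_mono lim)
        have "q (\<lambda>x. f n (T k x)) = q (f n)"
          unfolding q_def by (intro comp_int) (auto intro: C_sq f k)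
        moreover have "(4::real) / 4 ^ n = 4 * (1 / 4 ^ n)" by simp
        ultimately have "(\<integral>x. (?b x)\<^sup>2 \<partial>M) \<le> 4 / 4 ^ n"
          using parallelogram[OF C_translate[OF f k] f, of n n] q_f[of n] by linarith
        then show "(\<integral>\<^sup>+x. ennreal ((?b x)\<^sup>2) \<partial>M) \<le> ennreal (4 / 4 ^ n)"
          using diff_int[OF C_translate[OF f k] f, of n n]
          by (subst nn_integral_eq_integral) (auto intro: ennreal_leI)
      qed auto
      also have "\<dots> = ennreal (36 / 4 ^ n)"
        by (simp flip: ennreal_plus ennreal_mult ennreal_numeral)
      finally show ?thesis .
    qed
    then have "(\<integral>\<^sup>+x. ennreal ((g (T k x) - g x)\<^sup>2) \<partial>M) = 0"
      by (rule zero_limit)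
    then show ?thesis
      by (subst (asm) nn_integral_0_iff_AE) (auto elim!: eventually_mono)
  qed
  \<comment> \<open>Every member of C has squared norm at least \<delta>^2 / (e + 1): apply u \<le> t u^2 + 1/(4 t) on E, with t
     chosen so that the second summand uses up at most half of \<delta>. So the minimizer cannot vanish.\<close>
  define e where "e = measure M E"
  have lower: "\<delta>\<^sup>2 / (e + 1) \<le> q u" if "u \<in> C" for u
  proof -
    define t where "t = (e + 1) / (2 * \<delta>)"
    have "0 \<le> e" "0 < t"
      using \<open>0 < \<delta>\<close> by (auto simp: e_def t_def intro!: divide_pos_pos add_nonneg_pos)
    note [measurable] = C_meas[OF that]
    have "\<delta> \<le> (\<integral>x. u (T \<one> x) * indicator E x \<partial>M)"
      using that by (auto simp: C_def)
    also have "\<dots> = (\<integral>x. u x * indicator E x \<partial>M)"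
      by (intro Bochner_Integration.integral_cong) (auto simp: T_one)
    also have "\<dots> \<le> (\<integral>x. t * (u x)\<^sup>2 + indicator E x / (4 * t) \<partial>M)"
    proof (intro integral_mono)
      show "integrable M (\<lambda>x. u x * indicator E x)"
        using that by (intro prod_int C_sq E_sq) auto
      show "integrable M (\<lambda>x. t * (u x)\<^sup>2 + indicator E x / (4 * t))"
        using E_int C_sq[OF that] by auto
      fix x
      have "0 \<le> (2 * t * u x - indicator E x)\<^sup>2"
        by simp
      then have "4 * t * (u x * indicator E x) \<le> 4 * t * (t * (u x)\<^sup>2) + indicator E x"
        by (auto simp: power2_eq_square algebra_simps indicator_def split: if_splits)
      then show "u x * indicator E x \<le> t * (u x)\<^sup>2 + indicator E x / (4 * t)"
        using \<open>0 < t\<close> by (simp add: field_simps)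
    qed
    also have "\<dots> = t * q u + e / (4 * t)"
      using E_int C_sq[OF that] sets.sets_into_space[OF E(1)] by (simp add: q_def e_def Int_absorb2)
    finally have "\<delta> \<le> t * q u + e / (4 * t)" .
    moreover have "e / (4 * t) \<le> \<delta> / 2"
      using \<open>0 \<le> e\<close> \<open>0 < \<delta>\<close> by (simp add: t_def field_simps)
    ultimately have "\<delta> / 2 \<le> t * q u" by linarith
    then have "\<delta> \<le> ((e + 1) / \<delta>) * q u" by (simp add: t_def)
    then show ?thesis
      using \<open>0 \<le> e\<close> \<open>0 < \<delta>\<close> by (simp add: field_simps power2_eq_square)
  qed
  have e1: "0 < \<delta>\<^sup>2 / (e + 1)"
    using \<open>0 < \<delta>\<close> by (auto simp: e_def intro!: divide_pos_pos add_nonneg_pos)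
  have nonzero: "\<not> (AE x in M. g x = 0)"
  proof
    assume "AE x in M. g x = 0"
    have "ennreal (\<delta>\<^sup>2 / (e + 1)) \<le> ennreal (4 / 4 ^ n)" for n
    proof -
      have "ennreal (\<delta>\<^sup>2 / (e + 1)) \<le> (\<integral>\<^sup>+x. ennreal ((f n x)\<^sup>2) \<partial>M)"
        using lower[OF f[of n]] by (subst nn_integral_eq_integral) (auto intro: C_sq f simp: q_def ennreal_leI)
      also have "\<dots> = (\<integral>\<^sup>+x. ennreal ((g x - f n x)\<^sup>2) \<partial>M)"
        using \<open>AE x in M. g x = 0\<close> by (intro nn_integral_cong_AE) (auto elim!: eventually_mono)
      finally show ?thesis using lim[of n] by (rule order_trans)
    qed
    then have "ennreal (\<delta>\<^sup>2 / (e + 1)) = 0" by (rule zero_limit)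
    then show False using e1 by (simp add: ennreal_eq_0_iff)
  qed
  have g_finite: "(\<integral>\<^sup>+x. ennreal ((g x)\<^sup>2) \<partial>M) < \<infinity>"
  proof -
    have "(\<integral>\<^sup>+x. ennreal ((g x)\<^sup>2) \<partial>M)
        \<le> (\<integral>\<^sup>+x. 2 * (ennreal ((g x - f 0 x)\<^sup>2) + ennreal ((f 0 x)\<^sup>2)) \<partial>M)"
    proof (intro nn_integral_mono)
      fix x
      have "0 \<le> (g x - f 0 x - f 0 x)\<^sup>2" by simp
      then have "(g x)\<^sup>2 \<le> 2 * ((g x - f 0 x)\<^sup>2 + (f 0 x)\<^sup>2)"
        by (simp add: power2_eq_square algebra_simps)
      then have "ennreal ((g x)\<^sup>2) \<le> ennreal (2 * ((g x - f 0 x)\<^sup>2 + (f 0 x)\<^sup>2))"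
        by (rule ennreal_leI)
      then show "ennreal ((g x)\<^sup>2) \<le> 2 * (ennreal ((g x - f 0 x)\<^sup>2) + ennreal ((f 0 x)\<^sup>2))"
        by (simp add: ennreal_mult ennreal_plus)
    qed
    also have "\<dots> = 2 * ((\<integral>\<^sup>+x. ennreal ((g x - f 0 x)\<^sup>2) \<partial>M) + (\<integral>\<^sup>+x. ennreal ((f 0 x)\<^sup>2) \<partial>M))"
      by (simp add: nn_integral_cmult nn_integral_add)
    also have "\<dots> \<le> 2 * (ennreal 4 + ennreal (q (f 0)))"
      using lim[of 0] by (intro mult_left_mono add_mono) (auto simp: q_def nn_integral_eq_integral C_sq[OF f])
    also have "\<dots> < \<infinity>"
      by (simp add: ennreal_mult_less_top)
    finally show ?thesis .
  qed
  define L where "L n = {x \<in> space M. 1 / real (Suc n) \<le> (g x)\<^sup>2}" for n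
  have L [measurable]: "L n \<in> sets M" for n
    unfolding L_def by measurable
  have "\<exists>n. emeasure M (L n) \<noteq> 0"
  proof (rule ccontr)
    assume "\<not> ?thesis"
    then have "L n \<in> null_sets M" for n by auto
    then have "(\<Union>n. L n) \<in> null_sets M" by blast
    then have "AE x in M. x \<notin> (\<Union>n. L n)" by (rule AE_not_in)
    then have "AE x in M. g x = 0"
    proof (rule AE_mp, intro AE_I2 impI)
      fix x assume x: "x \<in> space M" "x \<notin> (\<Union>n. L n)"
      show "g x = 0"
      proof (rule ccontr)
        assume "g x \<noteq> 0"
        then obtain n where "1 / real (Suc n) < (g x)\<^sup>2"
          using nat_approx_posE[of "(g x)\<^sup>2"] by auto
        then have "x \<in> L n" using x(1) by (simp add: L_def)
        then show False using x by blast
      qed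
    qed
    with nonzero show False by blast
  qed
  then obtain n where n: "emeasure M (L n) \<noteq> 0" by blast
  have L_fin: "emeasure M (L n) < \<infinity>"
  proof -
    have "emeasure M (L n) = (\<integral>\<^sup>+x. indicator (L n) x \<partial>M)" by simp
    also have "\<dots> \<le> (\<integral>\<^sup>+x. ennreal (real (Suc n)) * ennreal ((g x)\<^sup>2) \<partial>M)"
    proof (intro nn_integral_mono)
      fix x
      have "1 \<le> real (Suc n) * (g x)\<^sup>2" if "x \<in> L n"
        using that by (auto simp: L_def field_simps)
      then show "indicator (L n) x \<le> ennreal (real (Suc n)) * ennreal ((g x)\<^sup>2)"
        by (cases "x \<in> L n") (simp_all flip: ennreal_mult ennreal_1 del: of_nat_Suc)
    qed
    also have "\<dots> = ennreal (real (Suc n)) * (\<integral>\<^sup>+x. ennreal ((g x)\<^sup>2) \<partial>M)"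
      by (simp add: nn_integral_cmult)
    also have "\<dots> < \<infinity>"
      using g_finite by (auto simp: ennreal_mult_less_top)
    finally show ?thesis .
  qed
  define B where "B = {x \<in> space M. \<forall>k\<in>carrier K. T k x \<in> L n}"
  have pre: "{x \<in> space M. T k x \<in> L n} \<in> sets M" if "k \<in> carrier K" for k
    using measurable_sets[OF T[OF that] L[of n]] by (simp add: vimage_def Int_def conj_commute)
  have B_eq: "B = (\<Inter>k\<in>carrier K. {x \<in> space M. T k x \<in> L n})"
    using one_closed by (auto simp: B_def)
  have B_meas [measurable]: "B \<in> sets M"
    unfolding B_eq using countable pre one_closed by (intro sets.countable_INT') auto
  have "AE x in M. \<forall>k\<in>carrier K. g (T k x) = g x"
    using countable invariant by (simp add: AE_ball_countable)
  then have "AE x in M. x \<in> B \<longleftrightarrow> x \<in> L n"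
  proof (rule AE_mp, intro AE_I2 impI)
    fix x assume x: "x \<in> space M" and inv: "\<forall>k\<in>carrier K. g (T k x) = g x"
    then show "x \<in> B \<longleftrightarrow> x \<in> L n"
      using one_closed T_space by (auto simp: B_def L_def)
  qed
  then have "emeasure M B = emeasure M (L n)"
    by (intro emeasure_eq_AE) auto
  moreover have "T k x \<in> B \<longleftrightarrow> x \<in> B" if k: "k \<in> carrier K" and x: "x \<in> space M" for k x
  proof
    assume "x \<in> B"
    then have "T h (T k x) \<in> L n" if "h \<in> carrier K" for h
      using k x that by (auto simp: B_def simp flip: T_mult)
    then show "T k x \<in> B"
      using T_space[OF k x] by (auto simp: B_def)
  next
    assume *: "T k x \<in> B"
    have "T h x \<in> L n" if h: "h \<in> carrier K" for h
    proof -
      have "T h x = T (h \<otimes> inv k) (T k x)"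
        using h k x by (simp add: T_mult[symmetric] m_assoc)
      then show ?thesis
        using * h k by (auto simp: B_def)
    qed
    then show "x \<in> B" using x by (auto simp: B_def)
  qed
  ultimately show ?thesis
    using that[of B] n L_fin B_meas by (simp add: zero_less_iff_neq_zero)
qed

section \<open>Measure preserving actions and fundamental domains\<close>

text \<open>
  Choosing a representative of every right coset of \<open>L\<close> writes each group element as an element of \<open>L\<close>
  times a representative; \<open>r\<close> reads off the first factor. It converts maps that are equivariant for the
  group into maps that are equivariant for the subgroup.
\<close>

lemma (in group) subgroup_equivariant_retraction:
  assumes "subgroup L G"
  obtains r where "\<And>k. k \<in> carrier G \<Longrightarrow> r k \<in> L"
    and "\<And>l k. l \<in> L \<Longrightarrow> k \<in> carrier G \<Longrightarrow> r (l \<otimes> k) = l \<otimes> r k"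
proof -
  interpret L: subgroup L G by fact
  define rep where "rep k = (SOME j. j \<in> L #> k)" for k
  have rep: "rep k \<in> L #> k" if "k \<in> carrier G" for k
    unfolding rep_def using that assms rcos_self[of k L] by (intro someI[of "\<lambda>j. j \<in> L #> k"])
  have rep_mult: "rep (l \<otimes> k) = rep k" if "l \<in> L" "k \<in> carrier G" for l k
  proof -
    have "L #> (l \<otimes> k) = L #> k"
      using that assms coset_mult_assoc[OF L.subset, of l k] coset_join2[of l L] L.mem_carrier by simp
    then show ?thesis by (simp add: rep_def)
  qed
  have rep_carrier: "rep k \<in> carrier G" if "k \<in> carrier G" for k
    using rep[OF that] r_coset_subset_G[OF L.subset that] by blast
  show ?thesis
  proof (rule that[of "\<lambda>k. k \<otimes> inv (rep k)"])
    fix k assume k: "k \<in> carrier G"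
    then obtain l where l: "l \<in> L" "rep k = l \<otimes> k"
      using rep[OF k] by (auto simp: r_coset_def)
    then have "k \<otimes> inv (rep k) = inv l"
      using k L.mem_carrier by (simp add: inv_mult_group flip: m_assoc)
    then show "k \<otimes> inv (rep k) \<in> L"
      using l by simp
  next
    fix l k assume "l \<in> L" "k \<in> carrier G"
    then show "l \<otimes> k \<otimes> inv (rep (l \<otimes> k)) = l \<otimes> (k \<otimes> inv (rep k))"
      using rep_mult rep_carrier L.mem_carrier by (simp add: m_assoc)
  qed
qed

context measure_preserving_action
begin

lemma group_K: "group K"
  using group_hom by (rule group_hom.axioms(1))

lemma act_closed: "k \<in> carrier K \<Longrightarrow> x \<in> space M \<Longrightarrow> \<phi> k x \<in> space M"
  using element_image by blast

lemma act_one: "x \<in> space M \<Longrightarrow> \<phi> \<one>\<^bsub>K\<^esub> x = x"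
  using id_eq_one by (metis restrict_apply')

lemma act_mult:
  "h \<in> carrier K \<Longrightarrow> k \<in> carrier K \<Longrightarrow> x \<in> space M \<Longrightarrow> \<phi> (h \<otimes>\<^bsub>K\<^esub> k) x = \<phi> h (\<phi> k x)"
  by (rule composition_rule)

lemma act_inv_cancel:
  assumes "k \<in> carrier K" "x \<in> space M"
  shows "\<phi> k (\<phi> (inv\<^bsub>K\<^esub> k) x) = x" and "\<phi> (inv\<^bsub>K\<^esub> k) (\<phi> k x) = x"
proof -
  interpret K: group K by (rule group_K)
  show "\<phi> k (\<phi> (inv\<^bsub>K\<^esub> k) x) = x" and "\<phi> (inv\<^bsub>K\<^esub> k) (\<phi> k x) = x"
    using assms by (simp_all add: act_one flip: act_mult)
qed

lemma mem_image_iff: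
  assumes "k \<in> carrier K" "A \<subseteq> space M" "x \<in> space M"
  shows "x \<in> \<phi> k ` A \<longleftrightarrow> \<phi> (inv\<^bsub>K\<^esub> k) x \<in> A"
proof -
  interpret K: group K by (rule group_K)
  show ?thesis
    using assms act_inv_cancel[OF assms(1)] by (force simp: image_iff subset_eq)
qed

lemma image_subset: "k \<in> carrier K \<Longrightarrow> A \<subseteq> space M \<Longrightarrow> \<phi> k ` A \<subseteq> space M"
  using act_closed by blast

lemma image_eq_vimage:
  assumes "k \<in> carrier K" "A \<subseteq> space M"
  shows "\<phi> k ` A = \<phi> (inv\<^bsub>K\<^esub> k) -` A \<inter> space M"
  using mem_image_iff[OF assms] image_subset[OF assms] by blast

lemma sets_image:
  assumes "k \<in> carrier K" "A \<in> sets M"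
  shows "\<phi> k ` A \<in> sets M"
proof -
  interpret K: group K by (rule group_K)
  show ?thesis
    using assms measurable_sets[OF measurable_action[of "inv\<^bsub>K\<^esub> k"]]
    by (simp add: image_eq_vimage sets.sets_into_space)
qed

lemma nn_integral_act:
  assumes "k \<in> carrier K" "f \<in> borel_measurable M"
  shows "(\<integral>\<^sup>+x. f (\<phi> k x) \<partial>M) = (\<integral>\<^sup>+x. f x \<partial>M)"
  using nn_integral_distr[OF measurable_action[OF assms(1)], of f] assms
  by (simp add: preserves_measure)

lemma emeasure_image:
  assumes "k \<in> carrier K" "A \<in> sets M"
  shows "emeasure M (\<phi> k ` A) = emeasure M A"
proof -
  interpret K: group K by (rule group_K)
  have "emeasure M A = emeasure (distr M M (\<phi> (inv\<^bsub>K\<^esub> k))) A"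
    using assms by (simp add: preserves_measure)
  also have "\<dots> = emeasure M (\<phi> k ` A)"
    using assms
    by (simp add: emeasure_distr measurable_action image_eq_vimage sets.sets_into_space)
  finally show ?thesis ..
qed

text \<open>
  Restrictions to subgroups and to the two factors of a product are all instances of this.
\<close>

lemma pullback_action:
  assumes "group L" and "f \<in> hom L K"
  shows "measure_preserving_action L M (\<lambda>l. \<phi> (f l))"
proof -
  have f: "f l \<in> carrier K" if "l \<in> carrier L" for l
    using assms(2) that by (auto simp: hom_def)
  have "\<phi> \<in> hom K (BijGroup (space M))"
    using group_hom by (simp add: group_hom_def group_hom_axioms_def)
  then have "(\<lambda>l. \<phi> (f l)) \<in> hom L (BijGroup (space M))"
    using hom_compose[OF assms(2)] by (simp add: comp_def)
  then have "group_hom L (BijGroup (space M)) (\<lambda>l. \<phi> (f l))"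
    using assms(1) by (simp add: group_hom_def group_hom_axioms_def group_BijGroup)
  then show ?thesis
    using f by (intro measure_preserving_action.intro group_action.intro measure_preserving_action_axioms.intro)
      (auto simp: measurable_action preserves_measure)
qed

text \<open>
  The part of \<open>V\<close> inside \<open>k W\<close> and the part of \<open>W\<close> inside \<open>k\<^sup>-\<^sup>1 V\<close> are translates of each other, and the
  invariant set \<open>B\<close> does not notice the translation; sum over \<open>k\<close>. In terms of the quotient by the action,
  both sides compute the measure of the intersection of the images of \<open>V\<close>, \<open>W\<close> and \<open>B\<close>.
\<close>

lemma emeasure_exchange:
  assumes countable: "countable (carrier K)"
    and V: "V \<in> sets M" "disjoint_family_on (\<lambda>k. \<phi> k ` V) (carrier K)"
    and W: "W \<in> sets M" "disjoint_family_on (\<lambda>k. \<phi> k ` W) (carrier K)"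
    and B: "B \<in> sets M" "\<And>k. k \<in> carrier K \<Longrightarrow> \<phi> k ` B = B"
  shows "emeasure M (V \<inter> B \<inter> (\<Union>k\<in>carrier K. \<phi> k ` W))
       = emeasure M (W \<inter> B \<inter> (\<Union>k\<in>carrier K. \<phi> k ` V))"
proof -
  interpret K: group K by (rule group_K)
  have split: "emeasure M (V \<inter> B \<inter> (\<Union>k\<in>carrier K. \<phi> k ` W))
      = (\<integral>\<^sup>+k. emeasure M (V \<inter> B \<inter> \<phi> k ` W) \<partial>count_space (carrier K))"
    if V: "V \<in> sets M" and W: "W \<in> sets M" "disjoint_family_on (\<lambda>k. \<phi> k ` W) (carrier K)" for V W
  proof -
    have "emeasure M (\<Union>k\<in>carrier K. V \<inter> B \<inter> \<phi> k ` W)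
        = (\<integral>\<^sup>+k. emeasure M (V \<inter> B \<inter> \<phi> k ` W) \<partial>count_space (carrier K))"
    proof (rule emeasure_UN_countable)
      show "disjoint_family_on (\<lambda>k. V \<inter> B \<inter> \<phi> k ` W) (carrier K)"
        using W(2) by (auto simp: disjoint_family_on_def)
    qed (use V W B countable sets_image in auto)
    then show ?thesis by (simp only: Int_UN_distrib)
  qed
  have "emeasure M (V \<inter> B \<inter> (\<Union>k\<in>carrier K. \<phi> k ` W))
      = (\<integral>\<^sup>+k. emeasure M (V \<inter> B \<inter> \<phi> k ` W) \<partial>count_space (carrier K))"
    using V W by (intro split)
  also have "\<dots> = (\<integral>\<^sup>+k. emeasure M (W \<inter> B \<inter> \<phi> (inv\<^bsub>K\<^esub> k) ` V) \<partial>count_space (carrier K))"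
  proof (rule nn_integral_cong)
    fix k assume "k \<in> space (count_space (carrier K))"
    then have k: "k \<in> carrier K" by simp
    have "\<phi> (inv\<^bsub>K\<^esub> k) ` (V \<inter> B \<inter> \<phi> k ` W) = W \<inter> B \<inter> \<phi> (inv\<^bsub>K\<^esub> k) ` V"
    proof -
      have inj: "inj_on (\<phi> (inv\<^bsub>K\<^esub> k)) (space M)"
        using k by (intro inj_prop) simp
      have "\<phi> (inv\<^bsub>K\<^esub> k) ` (\<phi> k ` W) = W"
        using sets.sets_into_space[OF W(1)] act_inv_cancel(2)[OF k] by (force simp: image_iff subset_eq)
      moreover have "\<phi> (inv\<^bsub>K\<^esub> k) ` B = B"
        using k by (intro B) simp
      moreover have "\<phi> (inv\<^bsub>K\<^esub> k) ` (V \<inter> B \<inter> \<phi> k ` W)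
          = \<phi> (inv\<^bsub>K\<^esub> k) ` V \<inter> \<phi> (inv\<^bsub>K\<^esub> k) ` B \<inter> \<phi> (inv\<^bsub>K\<^esub> k) ` (\<phi> k ` W)"
        using sets.sets_into_space[OF V(1)] sets.sets_into_space[OF W(1)] sets.sets_into_space[OF B(1)]
          image_subset[OF k, of W]
        by (subst inj_on_image_Int[OF inj], blast, blast, subst inj_on_image_Int[OF inj], blast, blast, simp)
      ultimately show ?thesis by auto
    qed
    then show "emeasure M (V \<inter> B \<inter> \<phi> k ` W) = emeasure M (W \<inter> B \<inter> \<phi> (inv\<^bsub>K\<^esub> k) ` V)"
      using emeasure_image[of "inv\<^bsub>K\<^esub> k" "V \<inter> B \<inter> \<phi> k ` W"] V W B sets_image k by auto
  qed
  also have "\<dots> = (\<integral>\<^sup>+k. emeasure M (W \<inter> B \<inter> \<phi> k ` V) \<partial>count_space (carrier K))"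
  proof (rule nn_integral_bij_count_space)
    show "bij_betw (\<lambda>k. inv\<^bsub>K\<^esub> k) (carrier K) (carrier K)"
      by (rule bij_betwI[where g = "\<lambda>k. inv\<^bsub>K\<^esub> k"]) auto
  qed
  also have "\<dots> = emeasure M (W \<inter> B \<inter> (\<Union>k\<in>carrier K. \<phi> k ` V))"
    using V W by (intro split[symmetric])
  finally show ?thesis .
qed

text \<open>
  A fundamental domain is the same thing as a measurable equivariant map to the group: \<open>\<pi> x\<close> is the index
  of the translate of the domain that contains \<open>x\<close>. The next lemma is the converse; passing through maps
  is what makes it easy to change the group.
\<close>

lemma equivariant_map_of_fundamental_domain:
  assumes countable: "countable (carrier K)"
    and D: "fundamental_domain M (carrier K) \<phi> (space M) D"
  obtains \<pi> where "\<pi> \<in> measurable M (count_space (carrier K))"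
    and "\<And>k x. k \<in> carrier K \<Longrightarrow> x \<in> space M \<Longrightarrow> \<pi> (\<phi> k x) = k \<otimes>\<^bsub>K\<^esub> \<pi> x"
    and "\<And>x. x \<in> space M \<Longrightarrow> \<pi> x = \<one>\<^bsub>K\<^esub> \<longleftrightarrow> x \<in> D"
proof -
  interpret K: group K by (rule group_K)
  have D_sets: "D \<in> sets M" and disj: "disjoint_family_on (\<lambda>k. \<phi> k ` D) (carrier K)"
    and cover: "(\<Union>k\<in>carrier K. \<phi> k ` D) = space M"
    using D by (auto simp: fundamental_domain_def)
  have D_space: "D \<subseteq> space M" using D_sets by (rule sets.sets_into_space)
  define \<pi> where "\<pi> x = (THE k. k \<in> carrier K \<and> x \<in> \<phi> k ` D)" for x
  have unique: "\<pi> x = k" if "k \<in> carrier K" "x \<in> \<phi> k ` D" for k x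
    unfolding \<pi>_def using that disj by (intro the_equality) (auto simp: disjoint_family_on_def)
  have mem: "\<pi> x \<in> carrier K" "x \<in> \<phi> (\<pi> x) ` D" if x: "x \<in> space M" for x
  proof -
    obtain k where "k \<in> carrier K" "x \<in> \<phi> k ` D" using x unfolding cover[symmetric] by blast
    then show "\<pi> x \<in> carrier K" "x \<in> \<phi> (\<pi> x) ` D" using unique[of k x] by auto
  qed
  show ?thesis
  proof (rule that[of \<pi>])
    show "\<pi> \<in> measurable M (count_space (carrier K))"
    proof (subst measurable_count_space_eq_countable[OF countable], intro conjI ballI)
      show "\<pi> \<in> space M \<rightarrow> carrier K" using mem by auto
      fix k assume k: "k \<in> carrier K"
      have "\<pi> -` {k} \<inter> space M = \<phi> k ` D"
        using mem unique[OF k] image_subset[OF k D_space] by auto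
      then show "\<pi> -` {k} \<inter> space M \<in> sets M"
        using sets_image[OF k D_sets] by simp
    qed
    show "\<pi> (\<phi> k x) = k \<otimes>\<^bsub>K\<^esub> \<pi> x" if k: "k \<in> carrier K" and x: "x \<in> space M" for k x
    proof (rule unique)
      obtain y where "y \<in> D" "x = \<phi> (\<pi> x) y" using mem(2)[OF x] by blast
      then show "\<phi> k x \<in> \<phi> (k \<otimes>\<^bsub>K\<^esub> \<pi> x) ` D"
        using act_mult[OF k mem(1)[OF x], of y] D_space by (metis imageI subsetD)
    qed (use k mem(1)[OF x] in simp)
    show "\<pi> x = \<one>\<^bsub>K\<^esub> \<longleftrightarrow> x \<in> D" if x: "x \<in> space M" for x
    proof
      assume "\<pi> x = \<one>\<^bsub>K\<^esub>"
      then obtain y where "y \<in> D" "x = \<phi> \<one>\<^bsub>K\<^esub> y" using mem(2)[OF x] by auto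
      then show "x \<in> D" using D_space act_one[of y] by auto
    next
      assume "x \<in> D"
      then have "x \<in> \<phi> \<one>\<^bsub>K\<^esub> ` D" using act_one[OF x] by (metis imageI)
      then show "\<pi> x = \<one>\<^bsub>K\<^esub>" by (intro unique) simp
    qed
  qed
qed

lemma fundamental_domain_of_equivariant_map:
  assumes "countable (carrier K)"
    and \<rho>: "\<rho> \<in> measurable M (count_space (carrier K))"
    and equivariant: "\<And>k x. k \<in> carrier K \<Longrightarrow> x \<in> space M \<Longrightarrow> \<rho> (\<phi> k x) = k \<otimes>\<^bsub>K\<^esub> \<rho> x"
    and B: "B \<in> sets M" "\<And>k x. k \<in> carrier K \<Longrightarrow> x \<in> space M \<Longrightarrow> \<phi> k x \<in> B \<longleftrightarrow> x \<in> B"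
  shows "fundamental_domain M (carrier K) \<phi> B {x \<in> B. \<rho> x = \<one>\<^bsub>K\<^esub>}"
proof -
  interpret K: group K by (rule group_K)
  let ?D = "{x \<in> B. \<rho> x = \<one>\<^bsub>K\<^esub>}"
  have B_space: "B \<subseteq> space M" using B(1) by (rule sets.sets_into_space)
  have \<rho>_carrier: "\<rho> x \<in> carrier K" if "x \<in> space M" for x
    using measurable_space[OF \<rho> that] by simp
  have "?D = B \<inter> (\<rho> -` {\<one>\<^bsub>K\<^esub>} \<inter> space M)"
    using B_space by auto
  then have "?D \<in> sets M"
    using B(1) measurable_sets[OF \<rho>, of "{\<one>\<^bsub>K\<^esub>}"] by simp
  moreover have image: "\<phi> k ` ?D = {x \<in> B. \<rho> x = k}" if k: "k \<in> carrier K" for k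
  proof -
    have "x \<in> \<phi> k ` ?D \<longleftrightarrow> x \<in> B \<and> \<rho> x = k" if x: "x \<in> space M" for x
    proof -
      have "x \<in> \<phi> k ` ?D \<longleftrightarrow> \<phi> (inv\<^bsub>K\<^esub> k) x \<in> ?D"
        using B_space k x by (intro mem_image_iff) auto
      also have "\<dots> \<longleftrightarrow> x \<in> B \<and> inv\<^bsub>K\<^esub> k \<otimes>\<^bsub>K\<^esub> \<rho> x = \<one>\<^bsub>K\<^esub>"
        using B(2) equivariant k x by simp
      also have "inv\<^bsub>K\<^esub> k \<otimes>\<^bsub>K\<^esub> \<rho> x = \<one>\<^bsub>K\<^esub> \<longleftrightarrow> \<rho> x = k"
        using k \<rho>_carrier[OF x] by (metis K.inv_closed K.inv_inv K.inv_equality K.l_inv K.inv_solve_left' K.r_one)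
      finally show ?thesis .
    qed
    then show ?thesis
      using B_space image_subset[OF k, of ?D] by blast
  qed
  moreover have "disjoint_family_on (\<lambda>k. \<phi> k ` ?D) (carrier K)"
    by (auto simp: disjoint_family_on_def image)
  moreover have "(\<Union>k\<in>carrier K. \<phi> k ` ?D) = B"
    using image \<rho>_carrier B_space by auto
  ultimately show ?thesis
    by (simp add: fundamental_domain_def)
qed

lemma nn_integral_unfold:
  assumes countable: "countable (carrier K)"
    and D: "fundamental_domain M (carrier K) \<phi> (space M) D"
    and f [measurable]: "f \<in> borel_measurable M"
  shows "(\<integral>\<^sup>+x. f x \<partial>M) = (\<integral>\<^sup>+x. (\<integral>\<^sup>+k. f (\<phi> k x) \<partial>count_space (carrier K)) * indicator D x \<partial>M)"
proof -
  interpret K: group K by (rule group_K)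
  obtain \<pi> where \<pi> [measurable]: "\<pi> \<in> measurable M (count_space (carrier K))"
    and equivariant: "\<And>k x. k \<in> carrier K \<Longrightarrow> x \<in> space M \<Longrightarrow> \<pi> (\<phi> k x) = k \<otimes>\<^bsub>K\<^esub> \<pi> x"
    and \<pi>_one: "\<And>x. x \<in> space M \<Longrightarrow> \<pi> x = \<one>\<^bsub>K\<^esub> \<longleftrightarrow> x \<in> D"
    using equivariant_map_of_fundamental_domain[OF countable D] by blast
  have [measurable]: "D \<in> sets M" using D by (simp add: fundamental_domain_def)
  have \<pi>_carrier: "\<pi> x \<in> carrier K" if "x \<in> space M" for x
    using measurable_space[OF \<pi> that] by simp
  have fibre: "(\<lambda>x. f x * indicator {x \<in> space M. \<pi> x = k} x) \<in> borel_measurable M"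
    if "k \<in> carrier K" for k
  proof -
    have [measurable]: "{x \<in> space M. \<pi> x = k} \<in> sets M"
      using measurable_sets[OF \<pi>, of "{k}"] that by (simp add: vimage_def Int_def conj_commute)
    show ?thesis by measurable
  qed
  have "(\<integral>\<^sup>+x. (\<integral>\<^sup>+k. f (\<phi> k x) \<partial>count_space (carrier K)) * indicator D x \<partial>M)
      = (\<integral>\<^sup>+x. (\<integral>\<^sup>+k. f (\<phi> k x) * indicator D x \<partial>count_space (carrier K)) \<partial>M)"
    by (simp add: nn_integral_multc)
  also have "\<dots> = (\<integral>\<^sup>+k. (\<integral>\<^sup>+x. f (\<phi> k x) * indicator D x \<partial>M) \<partial>count_space (carrier K))"
  proof (rule nn_integral_count_space_nn_integral[OF countable])
    fix k assume "k \<in> carrier K"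
    note [measurable] = measurable_action[OF this]
    show "(\<lambda>x. f (\<phi> k x) * indicator D x) \<in> borel_measurable M" by measurable
  qed
  also have "\<dots> = (\<integral>\<^sup>+k. (\<integral>\<^sup>+x. f x * indicator {x \<in> space M. \<pi> x = k} x \<partial>M) \<partial>count_space (carrier K))"
  proof (rule nn_integral_cong)
    fix k assume "k \<in> space (count_space (carrier K))"
    then have k: "k \<in> carrier K" by simp
    have "(\<integral>\<^sup>+x. f (\<phi> k x) * indicator D x \<partial>M)
        = (\<integral>\<^sup>+x. f (\<phi> k x) * indicator {x \<in> space M. \<pi> x = k} (\<phi> k x) \<partial>M)"
    proof (rule nn_integral_cong)
      fix x assume x: "x \<in> space M"
      have "k \<otimes>\<^bsub>K\<^esub> \<pi> x = k \<longleftrightarrow> \<pi> x = \<one>\<^bsub>K\<^esub>"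
        using k \<pi>_carrier[OF x] by (metis K.l_cancel K.one_closed K.r_one)
      then show "f (\<phi> k x) * indicator D x = f (\<phi> k x) * indicator {x \<in> space M. \<pi> x = k} (\<phi> k x)"
        using k x equivariant \<pi>_one act_closed by (auto simp: indicator_def)
    qed
    also have "\<dots> = (\<integral>\<^sup>+x. f x * indicator {x \<in> space M. \<pi> x = k} x \<partial>M)"
      using nn_integral_act[OF k fibre[OF k]] .
    finally show "(\<integral>\<^sup>+x. f (\<phi> k x) * indicator D x \<partial>M)
        = (\<integral>\<^sup>+x. f x * indicator {x \<in> space M. \<pi> x = k} x \<partial>M)" .
  qed
  also have "\<dots> = (\<integral>\<^sup>+x. (\<integral>\<^sup>+k. f x * indicator {x \<in> space M. \<pi> x = k} x \<partial>count_space (carrier K)) \<partial>M)"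
    by (intro nn_integral_count_space_nn_integral[OF countable, symmetric] fibre)
  also have "\<dots> = (\<integral>\<^sup>+x. f x \<partial>M)"
  proof (rule nn_integral_cong)
    fix x assume x: "x \<in> space M"
    have "(\<integral>\<^sup>+k. f x * indicator {x \<in> space M. \<pi> x = k} x \<partial>count_space (carrier K))
        = (\<integral>\<^sup>+k. f x * indicator {\<pi> x} k \<partial>count_space (carrier K))"
      using x by (intro nn_integral_cong) (auto simp: indicator_def)
    also have "\<dots> = f x"
      using \<pi>_carrier[OF x] by (simp add: nn_integral_cmult)
    finally show "(\<integral>\<^sup>+k. f x * indicator {x \<in> space M. \<pi> x = k} x \<partial>count_space (carrier K)) = f x" .
  qed
  finally show ?thesis ..
qed

definition saturation
  where "saturation A = (\<Union>k\<in>carrier K. \<phi> k ` A)"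

lemma equivariant_map_to_subgroup:
  assumes countable: "countable (carrier K)"
    and D: "fundamental_domain M (carrier K) \<phi> (space M) D"
    and L: "subgroup L K"
  obtains \<rho> where "\<rho> \<in> measurable M (count_space L)"
    and "\<And>l x. l \<in> L \<Longrightarrow> x \<in> space M \<Longrightarrow> \<rho> (\<phi> l x) = l \<otimes>\<^bsub>K\<^esub> \<rho> x"
proof -
  interpret K: group K by (rule group_K)
  obtain \<pi> where \<pi>: "\<pi> \<in> measurable M (count_space (carrier K))"
    and equivariant: "\<And>k x. k \<in> carrier K \<Longrightarrow> x \<in> space M \<Longrightarrow> \<pi> (\<phi> k x) = k \<otimes>\<^bsub>K\<^esub> \<pi> x"
    and "\<And>x. x \<in> space M \<Longrightarrow> \<pi> x = \<one>\<^bsub>K\<^esub> \<longleftrightarrow> x \<in> D"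
    using equivariant_map_of_fundamental_domain[OF countable D] by blast
  obtain r where r: "\<And>k. k \<in> carrier K \<Longrightarrow> r k \<in> L"
    and r_mult: "\<And>l k. l \<in> L \<Longrightarrow> k \<in> carrier K \<Longrightarrow> r (l \<otimes>\<^bsub>K\<^esub> k) = l \<otimes>\<^bsub>K\<^esub> r k"
    using K.subgroup_equivariant_retraction[OF L] by blast
  show ?thesis
  proof (rule that[of "\<lambda>x. r (\<pi> x)"])
    have "r \<in> measurable (count_space (carrier K)) (count_space L)"
      using r by (simp add: measurable_count_space_eq1)
    then show "(\<lambda>x. r (\<pi> x)) \<in> measurable M (count_space L)"
      using \<pi> by (rule measurable_compose[rotated])
    show "r (\<pi> (\<phi> l x)) = l \<otimes>\<^bsub>K\<^esub> r (\<pi> x)" if "l \<in> L" "x \<in> space M" for l x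
      using that equivariant r_mult measurable_space[OF \<pi> that(2)] subgroup.mem_carrier[OF L] by simp
  qed
qed

lemma image_eq_self:
  assumes "k \<in> carrier K" "B \<subseteq> space M" "\<And>x. x \<in> space M \<Longrightarrow> \<phi> k x \<in> B \<longleftrightarrow> x \<in> B"
  shows "\<phi> k ` B = B"
proof -
  interpret K: group K by (rule group_K)
  have "x \<in> \<phi> k ` B \<longleftrightarrow> x \<in> B" if x: "x \<in> space M" for x
    using mem_image_iff[OF assms(1,2) x] assms(3)[of "\<phi> (inv\<^bsub>K\<^esub> k) x"]
      act_inv_cancel[OF assms(1) x] act_closed[OF K.inv_closed[OF assms(1)] x] by simp
  then show ?thesis
    using assms(2) image_subset[OF assms(1,2)] by blast
qed

lemma saturation_subset: "A \<subseteq> space M \<Longrightarrow> saturation A \<subseteq> space M"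
  unfolding saturation_def using image_subset by blast

lemma sets_saturation:
  assumes "countable (carrier K)" "A \<in> sets M"
  shows "saturation A \<in> sets M"
  unfolding saturation_def using assms sets_image by (intro sets.countable_UN'') auto

lemma mem_saturation_iff:
  assumes "A \<subseteq> space M" "k \<in> carrier K" "x \<in> space M"
  shows "\<phi> k x \<in> saturation A \<longleftrightarrow> x \<in> saturation A"
proof -
  interpret K: group K by (rule group_K)
  have *: "\<phi> k x \<in> saturation A" if k: "k \<in> carrier K" and x: "x \<in> saturation A" for k x
  proof -
    obtain h y where "h \<in> carrier K" "y \<in> A" "x = \<phi> h y"
      using x unfolding saturation_def by blast
    then have "\<phi> k x = \<phi> (k \<otimes>\<^bsub>K\<^esub> h) y" "k \<otimes>\<^bsub>K\<^esub> h \<in> carrier K"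
      using k assms(1) by (auto simp: act_mult subset_eq)
    then show ?thesis
      using \<open>y \<in> A\<close> unfolding saturation_def by blast
  qed
  show ?thesis
    using *[of k x] *[of "inv\<^bsub>K\<^esub> k" "\<phi> k x"] assms act_inv_cancel(2)[OF assms(2,3)] by auto
qed

lemma emeasure_saturation:
  assumes countable: "countable (carrier K)"
    and V: "V \<in> sets M" "disjoint_family_on (\<lambda>k. \<phi> k ` V) (carrier K)"
    and W: "fundamental_domain M (carrier K) \<phi> (space M) W"
    and B: "B \<in> sets M" "\<And>k. k \<in> carrier K \<Longrightarrow> \<phi> k ` B = B"
  shows "emeasure M (saturation V \<inter> B \<inter> W) = emeasure M (V \<inter> B)"
proof -
  have "emeasure M (saturation V \<inter> B \<inter> W) = emeasure M (W \<inter> B \<inter> (\<Union>k\<in>carrier K. \<phi> k ` V))"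
    by (simp add: saturation_def Int_ac)
  also have "\<dots> = emeasure M (V \<inter> B \<inter> (\<Union>k\<in>carrier K. \<phi> k ` W))"
    using W by (intro emeasure_exchange[OF countable _ _ V B]) (auto simp: fundamental_domain_def)
  also have "V \<inter> B \<inter> (\<Union>k\<in>carrier K. \<phi> k ` W) = V \<inter> B"
    using W sets.sets_into_space[OF B(1)] unfolding fundamental_domain_def by blast
  finally show ?thesis .
qed

end

section \<open>Amenability from almost invariant densities\<close>

text \<open>
  Finitely additive probability measures form a compact space, as a closed subset of the product of
  copies of the unit interval indexed by the subsets of the group. The conditions of being
  \<open>e\<close>-invariant under \<open>g\<close> cut out closed subsets with the finite intersection property, and a point in
  all of them is an invariant mean.
\<close>

lemma amenable_of_almost_invariant_means:
  fixes Z (structure)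
  assumes "group Z"
    and approx: "\<And>F \<epsilon>. finite F \<Longrightarrow> F \<subseteq> carrier Z \<Longrightarrow> 0 < \<epsilon> \<Longrightarrow>
      \<exists>m :: 'a set \<Rightarrow> real. m (carrier Z) = 1 \<and> (\<forall>A \<subseteq> carrier Z. 0 \<le> m A) \<and>
        (\<forall>A \<subseteq> carrier Z. \<forall>B \<subseteq> carrier Z. A \<inter> B = {} \<longrightarrow> m (A \<union> B) = m A + m B) \<and>
        (\<forall>g \<in> F. \<forall>A \<subseteq> carrier Z. \<bar>m (g <# A) - m A\<bar> \<le> \<epsilon>)"
  shows "amenable Z"
proof -
  interpret group Z by fact
  define C where "C = carrier Z"
  define T where "T = product_topology (\<lambda>A. top_of_set {0..1::real}) (Pow C)"
  have top_T: "topspace T = Pow C \<rightarrow>\<^sub>E {0..1}"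
    by (simp add: T_def)
  have T_compact: "compact_space T"
    unfolding T_def by (simp add: compact_space_product_topology compact_space_subtopology)
  have eval: "continuous_map T euclideanreal (\<lambda>m. m A)" if "A \<subseteq> C" for A
  proof (rule continuous_map_into_fulltopology)
    show "continuous_map T (top_of_set {0..1}) (\<lambda>m. m A)"
      unfolding T_def using that continuous_map_product_projection[of A "Pow C" "\<lambda>A. top_of_set {0..1::real}"] by simp
  qed
  define E where "E g e = {m \<in> topspace T. m C \<in> {1}} \<inter>
      (\<Inter>(A, B)\<in>{(A, B). A \<subseteq> C \<and> B \<subseteq> C \<and> A \<inter> B = {}}. {m \<in> topspace T. m (A \<union> B) - (m A + m B) \<in> {0}}) \<inter>
      (\<Inter>A\<in>Pow C. {m \<in> topspace T. m (g <# A) - m A \<in> {-e..e}})" for g e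
  have closed_E: "closedin T (E g e)" if "g \<in> C" for g e
  proof -
    have preimage: "closedin T {m \<in> topspace T. f m \<in> S}"
      if "continuous_map T euclideanreal f" "closed S" for f S
      using closedin_continuous_map_preimage[OF that(1)] that(2) by simp
    have "closedin T {m \<in> topspace T. m C \<in> {1}}"
      by (intro preimage eval) auto
    moreover have "closedin T (\<Inter>(A, B)\<in>{(A, B). A \<subseteq> C \<and> B \<subseteq> C \<and> A \<inter> B = {}}.
        {m \<in> topspace T. m (A \<union> B) - (m A + m B) \<in> {0}})"
    proof (rule closedin_INT; clarify?)
      fix A B assume "A \<subseteq> C" "B \<subseteq> C"
      then show "closedin T {m \<in> topspace T. m (A \<union> B) - (m A + m B) \<in> {0}}"
        by (intro preimage continuous_map_diff continuous_map_add eval) auto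
    qed auto
    moreover have "closedin T (\<Inter>A\<in>Pow C. {m \<in> topspace T. m (g <# A) - m A \<in> {-e..e}})"
      using that l_coset_subset_G
      by (intro closedin_INT preimage continuous_map_diff eval) (auto simp: C_def)
    ultimately show ?thesis
      unfolding E_def by (intro closedin_Int)
  qed
  define U where "U = (\<lambda>(g, e). E g e) ` (C \<times> {0<..})"
  have "\<Inter>U \<noteq> {}"
  proof -
    have "\<forall>K\<in>U. closedin T K"
      using closed_E by (auto simp: U_def)
    moreover have "\<Inter>V \<noteq> {}" if V: "finite V" "V \<subseteq> U" for V
    proof -
      obtain J where J: "finite J" "J \<subseteq> C \<times> {0<..}" "V = (\<lambda>(g, e). E g e) ` J"
        using finite_subset_image[OF V[unfolded U_def]] by blast
      define \<epsilon> where "\<epsilon> = Min (insert 1 (snd ` J))"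
      have "0 < \<epsilon>" using J by (auto simp: \<epsilon>_def)
      have \<epsilon>_le: "\<epsilon> \<le> e" if "(g, e) \<in> J" for g e
      proof -
        have "e \<in> insert 1 (snd ` J)" using that by force
        then show ?thesis unfolding \<epsilon>_def using J(1) by (intro Min_le) auto
      qed
      have "finite (fst ` J)" "fst ` J \<subseteq> carrier Z"
        using J by (auto simp: C_def)
      note approx[OF this \<open>0 < \<epsilon>\<close>, folded C_def]
      then obtain m where m': "m C = (1 :: real) \<and> (\<forall>A \<subseteq> C. 0 \<le> m A) \<and>
          (\<forall>A \<subseteq> C. \<forall>B \<subseteq> C. A \<inter> B = {} \<longrightarrow> m (A \<union> B) = m A + m B) \<and>
          (\<forall>g \<in> fst ` J. \<forall>A \<subseteq> C. \<bar>m (g <# A) - m A\<bar> \<le> \<epsilon>)" ..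
      then have m: "m C = 1" "\<forall>A \<subseteq> C. 0 \<le> m A"
        and add: "\<forall>A \<subseteq> C. \<forall>B \<subseteq> C. A \<inter> B = {} \<longrightarrow> m (A \<union> B) = m A + m B"
        and inv: "\<forall>g \<in> fst ` J. \<forall>A \<subseteq> C. \<bar>m (g <# A) - m A\<bar> \<le> \<epsilon>"
        by blast+
      have "m A \<le> 1" if "A \<subseteq> C" for A
      proof -
        have "m (A \<union> (C - A)) = m A + m (C - A)"
          by (rule add[rule_format]) (use that in auto)
        moreover have "A \<union> (C - A) = C" using that by blast
        ultimately show ?thesis
          using m(1) m(2)[rule_format, of "C - A"] by auto
      qed
      then have "restrict m (Pow C) \<in> topspace T"
        using m by (auto simp: top_T)
      moreover have "g <# A \<subseteq> C" if "g \<in> C" "A \<subseteq> C" for g A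
        using that l_coset_subset_G by (auto simp: C_def)
      ultimately have "restrict m (Pow C) \<in> E g e" if "(g, e) \<in> J" for g e
      proof -
        have "g \<in> C" using J that by auto
        moreover have "m (g <# A) - m A \<in> {-e..e}" if "A \<subseteq> C" for A
        proof -
          have "g \<in> fst ` J" using \<open>(g, e) \<in> J\<close> by force
          then have "\<bar>m (g <# A) - m A\<bar> \<le> \<epsilon>" using inv that by blast
          then show ?thesis using \<epsilon>_le[OF \<open>(g, e) \<in> J\<close>] by auto
        qed
        ultimately show ?thesis
          using m add \<open>restrict m (Pow C) \<in> topspace T\<close> \<open>\<And>g A. g \<in> C \<Longrightarrow> A \<subseteq> C \<Longrightarrow> g <# A \<subseteq> C\<close>
          unfolding E_def by auto
      qed
      then have "restrict m (Pow C) \<in> \<Inter>V"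
        using J(3) by auto
      then show ?thesis by blast
    qed
    ultimately show ?thesis
      using T_compact[unfolded compact_space_fip, rule_format, of U] by blast
  qed
  then obtain m where m: "\<And>g e. g \<in> C \<Longrightarrow> 0 < e \<Longrightarrow> m \<in> E g e"
    by (auto simp: U_def)
  have m1: "m \<in> E \<one> 1"
    by (intro m) (auto simp: C_def)
  have "m (g <# A) = m A" if "g \<in> C" "A \<subseteq> C" for g A
  proof -
    have "\<bar>m (g <# A) - m A\<bar> \<le> 0 + e" if "0 < e" for e
    proof -
      have "m (g <# A) - m A \<in> {-e..e}"
        using m[OF \<open>g \<in> C\<close> that] \<open>A \<subseteq> C\<close> unfolding E_def by blast
      then show ?thesis by auto
    qed
    then have "\<bar>m (g <# A) - m A\<bar> \<le> 0"
      by (rule field_le_epsilon)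
    then show ?thesis by simp
  qed
  moreover have "0 \<le> m A" if "A \<subseteq> C" for A
    using m1 that by (auto simp: E_def top_T PiE_iff)
  moreover have "m C = 1" using m1 by (auto simp: E_def)
  moreover have "m (A \<union> B) = m A + m B" if "A \<subseteq> C" "B \<subseteq> C" "A \<inter> B = {}" for A B
    using m1 that by (auto simp: E_def)
  ultimately show ?thesis
    unfolding amenable_def C_def[symmetric] by (intro exI[of _ m]) auto
qed

text \<open>
  Pushing the densities forward along an equivariant map to the group gives probability measures on
  the group that move as little as the densities do.
\<close>

lemma (in measure_preserving_action) amenable_of_almost_invariant_densities:
  assumes q: "q \<in> measurable M (count_space (carrier K))"
    and equivariant: "\<And>k x. k \<in> carrier K \<Longrightarrow> x \<in> space M \<Longrightarrow> q (\<phi> k x) = k \<otimes>\<^bsub>K\<^esub> q x"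
    and "0 < c"
    and densities: "\<And>F \<epsilon>. finite F \<Longrightarrow> F \<subseteq> carrier K \<Longrightarrow> 0 < \<epsilon> \<Longrightarrow>
      \<exists>f. f \<in> borel_measurable M \<and> (\<forall>x. 0 \<le> f x) \<and> (\<integral>\<^sup>+x. ennreal (f x) \<partial>M) = ennreal c \<and>
        (\<forall>g\<in>F. (\<integral>\<^sup>+x. ennreal \<bar>f (\<phi> g x) - f x\<bar> \<partial>M) \<le> ennreal \<epsilon>)"
  shows "amenable K"
proof (rule amenable_of_almost_invariant_means[OF group_K])
  interpret K: group K by (rule group_K)
  fix F and \<epsilon> :: real
  assume F: "finite F" "F \<subseteq> carrier K" and "0 < \<epsilon>"
  obtain f where f [measurable]: "f \<in> borel_measurable M" and f_nonneg: "\<And>x. 0 \<le> f x"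
    and mass: "(\<integral>\<^sup>+x. ennreal (f x) \<partial>M) = ennreal c"
    and inv: "\<And>g. g \<in> F \<Longrightarrow> (\<integral>\<^sup>+x. ennreal \<bar>f (\<phi> g x) - f x\<bar> \<partial>M) \<le> ennreal (\<epsilon> * c)"
    using densities[of F "\<epsilon> * c"] F \<open>0 < \<epsilon>\<close> \<open>0 < c\<close> by auto
  define Q where "Q A = q -` A \<inter> space M" for A
  define I where "I A = (\<integral>\<^sup>+x. ennreal (f x) * indicator (Q A) x \<partial>M)" for A
  have fibre: "Q A \<in> sets M" if "A \<subseteq> carrier K" for A
    unfolding Q_def using measurable_sets[OF q, of A] that by simp
  have I_le: "I A \<le> ennreal c" for A
    unfolding I_def mass[symmetric] by (intro nn_integral_mono) (auto simp: indicator_def Q_def)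
  have I_total: "I (carrier K) = ennreal c"
    unfolding I_def mass[symmetric] using measurable_space[OF q]
    by (intro nn_integral_cong) (auto simp: indicator_def Q_def)
  have I_add: "I (A \<union> B) = I A + I B" if "A \<subseteq> carrier K" "B \<subseteq> carrier K" "A \<inter> B = {}" for A B
  proof -
    note [measurable] = fibre[OF that(1)] fibre[OF that(2)]
    have "I (A \<union> B) = (\<integral>\<^sup>+x. ennreal (f x) * indicator (Q A) x
        + ennreal (f x) * indicator (Q B) x \<partial>M)"
      unfolding I_def using that(3) by (intro nn_integral_cong) (auto simp: indicator_def Q_def)
    also have "\<dots> = I A + I B"
      unfolding I_def by (intro nn_integral_add; measurable)
    finally show ?thesis .
  qed
  have I_shift: "\<bar>enn2real (I (g <#\<^bsub>K\<^esub> A)) - enn2real (I A)\<bar> \<le> \<epsilon> * c"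
    if g: "g \<in> F" and A: "A \<subseteq> carrier K" for g A
  proof -
    have gK: "g \<in> carrier K" using g F by auto
    note [measurable] = fibre[OF A] measurable_action[OF gK]
    have gA: "g <#\<^bsub>K\<^esub> A \<subseteq> carrier K" using K.l_coset_subset_G[OF A gK] .
    have mem: "q (\<phi> g x) \<in> g <#\<^bsub>K\<^esub> A \<longleftrightarrow> q x \<in> A" if x: "x \<in> space M" for x
    proof -
      have "q x \<in> carrier K" using measurable_space[OF q x] by simp
      then show ?thesis
        using equivariant[OF gK x] gK A by (auto simp: l_coset_def)
    qed
    have shift: "I (g <#\<^bsub>K\<^esub> A) = (\<integral>\<^sup>+x. ennreal (f (\<phi> g x)) * indicator (Q A) x \<partial>M)"
    proof -
      have m: "(\<lambda>x. ennreal (f x) * indicator (Q (g <#\<^bsub>K\<^esub> A)) x) \<in> borel_measurable M"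
        using fibre[OF gA] by measurable
      show ?thesis
        unfolding I_def nn_integral_act[OF gK m, symmetric]
        using mem act_closed[OF gK] by (intro nn_integral_cong) (auto simp: indicator_def Q_def)
    qed
    define d where "d = (\<integral>\<^sup>+x. ennreal \<bar>f (\<phi> g x) - f x\<bar> \<partial>M)"
    have "I (g <#\<^bsub>K\<^esub> A) \<le> (\<integral>\<^sup>+x. ennreal (f x) * indicator (Q A) x + ennreal \<bar>f (\<phi> g x) - f x\<bar> \<partial>M)"
      unfolding shift using f_nonneg
      by (intro nn_integral_mono) (auto simp: indicator_def Q_def simp flip: ennreal_plus intro!: ennreal_leI)
    also have "\<dots> = I A + d"
      unfolding I_def d_def by (intro nn_integral_add; measurable)
    finally have 1: "I (g <#\<^bsub>K\<^esub> A) \<le> I A + d" .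
    have "I A \<le> (\<integral>\<^sup>+x. ennreal (f (\<phi> g x)) * indicator (Q A) x + ennreal \<bar>f (\<phi> g x) - f x\<bar> \<partial>M)"
      unfolding I_def using f_nonneg
      by (intro nn_integral_mono) (auto simp: indicator_def Q_def simp flip: ennreal_plus intro!: ennreal_leI)
    also have "\<dots> = I (g <#\<^bsub>K\<^esub> A) + d"
      unfolding shift d_def by (intro nn_integral_add; measurable)
    finally have 2: "I A \<le> I (g <#\<^bsub>K\<^esub> A) + d" .
    have d: "d \<le> ennreal (\<epsilon> * c)" using inv[OF g] by (simp add: d_def)
    obtain a where a: "I A = ennreal a" "0 \<le> a"
      using I_le[of A] by (cases "I A") (auto simp: top_unique)
    obtain b where b: "I (g <#\<^bsub>K\<^esub> A) = ennreal b" "0 \<le> b"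
      using I_le[of "g <#\<^bsub>K\<^esub> A"] by (cases "I (g <#\<^bsub>K\<^esub> A)") (auto simp: top_unique)
    have ec: "0 \<le> \<epsilon> * c" using \<open>0 < \<epsilon>\<close> \<open>0 < c\<close> by simp
    have "ennreal b \<le> ennreal a + ennreal (\<epsilon> * c)" "ennreal a \<le> ennreal b + ennreal (\<epsilon> * c)"
      using 1 2 d unfolding a b by (meson add_left_mono order_trans)+
    then have "b \<le> a + \<epsilon> * c" "a \<le> b + \<epsilon> * c"
      using a(2) b(2) ec by (simp_all flip: ennreal_plus)
    then show ?thesis
      unfolding a b using a(2) b(2) by (simp add: abs_le_iff)
  qed
  show "\<exists>m :: _ set \<Rightarrow> real. m (carrier K) = 1 \<and> (\<forall>A \<subseteq> carrier K. 0 \<le> m A) \<and>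
        (\<forall>A \<subseteq> carrier K. \<forall>B \<subseteq> carrier K. A \<inter> B = {} \<longrightarrow> m (A \<union> B) = m A + m B) \<and>
        (\<forall>g \<in> F. \<forall>A \<subseteq> carrier K. \<bar>m (g <#\<^bsub>K\<^esub> A) - m A\<bar> \<le> \<epsilon>)"
  proof (intro exI[of _ "\<lambda>A. enn2real (I A) / c"] conjI allI ballI impI)
    show "enn2real (I (carrier K)) / c = 1"
      using \<open>0 < c\<close> by (simp add: I_total)
    show "0 \<le> enn2real (I A) / c" for A
      using \<open>0 < c\<close> by simp
    show "enn2real (I (A \<union> B)) / c = enn2real (I A) / c + enn2real (I B) / c"
      if "A \<subseteq> carrier K" "B \<subseteq> carrier K" "A \<inter> B = {}" for A B
      using I_add[OF that] I_le[of A] I_le[of B]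
      by (simp add: enn2real_plus add_divide_distrib order_le_less_trans)
    show "\<bar>enn2real (I (g <#\<^bsub>K\<^esub> A)) / c - enn2real (I A) / c\<bar> \<le> \<epsilon>"
      if "g \<in> F" "A \<subseteq> carrier K" for g A
      using I_shift[OF that] \<open>0 < c\<close> by (simp add: field_simps flip: diff_divide_distrib)
  qed
qed

section \<open>The two commuting actions of a coupling\<close>

text \<open>
  The two factors of the product group act separately, and it is these two commuting actions that all
  arguments use.
\<close>

locale countable_ME_coupling = ME_coupling G \<Gamma> M \<phi>
  for G :: "('g, 'm) monoid_scheme" and \<Gamma> :: "('c, 'n) monoid_scheme"
    and M :: "'x measure" and \<phi> :: "'g \<times> 'c \<Rightarrow> 'x \<Rightarrow> 'x" +
  assumes group_G: "group G" and countable_G: "countable (carrier G)"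
    and group_\<Gamma>: "group \<Gamma>" and countable_\<Gamma>: "countable (carrier \<Gamma>)"
begin

abbreviation actG :: "'g \<Rightarrow> 'x \<Rightarrow> 'x" where "actG g \<equiv> \<phi> (g, \<one>\<^bsub>\<Gamma>\<^esub>)"
abbreviation act\<Gamma> :: "'c \<Rightarrow> 'x \<Rightarrow> 'x" where "act\<Gamma> \<gamma> \<equiv> \<phi> (\<one>\<^bsub>G\<^esub>, \<gamma>)"

sublocale G: group G by (rule group_G)
sublocale \<Gamma>: group \<Gamma> by (rule group_\<Gamma>)

lemma action_of_subgroup_G:
  assumes "subgroup L G"
  shows "measure_preserving_action (G\<lparr>carrier := L\<rparr>) M actG"
proof (rule pullback_action[where f = "\<lambda>g. (g, \<one>\<^bsub>\<Gamma>\<^esub>)"])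
  show "group (G\<lparr>carrier := L\<rparr>)"
    by (rule G.subgroup_imp_group[OF assms])
  show "(\<lambda>g. (g, \<one>\<^bsub>\<Gamma>\<^esub>)) \<in> hom (G\<lparr>carrier := L\<rparr>) (G \<times>\<times> \<Gamma>)"
    using subgroup.subset[OF assms] by (auto simp: hom_def DirProd_def)
qed

lemma action_of_subgroup_\<Gamma>:
  assumes "subgroup L \<Gamma>"
  shows "measure_preserving_action (\<Gamma>\<lparr>carrier := L\<rparr>) M act\<Gamma>"
proof (rule pullback_action[where f = "\<lambda>g. (\<one>\<^bsub>G\<^esub>, g)"])
  show "group (\<Gamma>\<lparr>carrier := L\<rparr>)"
    by (rule \<Gamma>.subgroup_imp_group[OF assms])
  show "(\<lambda>g. (\<one>\<^bsub>G\<^esub>, g)) \<in> hom (\<Gamma>\<lparr>carrier := L\<rparr>) (G \<times>\<times> \<Gamma>)"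
    using subgroup.subset[OF assms] by (auto simp: hom_def DirProd_def)
qed

sublocale actG: measure_preserving_action G M actG
  using action_of_subgroup_G[OF G.subgroup_self] by simp

sublocale act\<Gamma>: measure_preserving_action \<Gamma> M act\<Gamma>
  using action_of_subgroup_\<Gamma>[OF \<Gamma>.subgroup_self] by simp

lemma act_pair:
  assumes "g \<in> carrier G" "\<gamma> \<in> carrier \<Gamma>" "x \<in> space M"
  shows "\<phi> (g, \<gamma>) x = actG g (act\<Gamma> \<gamma> x)" and "\<phi> (g, \<gamma>) x = act\<Gamma> \<gamma> (actG g x)"
  using assms act_mult[of "(g, \<one>\<^bsub>\<Gamma>\<^esub>)" "(\<one>\<^bsub>G\<^esub>, \<gamma>)" x] act_mult[of "(\<one>\<^bsub>G\<^esub>, \<gamma>)" "(g, \<one>\<^bsub>\<Gamma>\<^esub>)" x]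
  by (simp_all add: DirProd_def)

lemma act_commute:
  assumes "g \<in> carrier G" "\<gamma> \<in> carrier \<Gamma>" "x \<in> space M"
  shows "actG g (act\<Gamma> \<gamma> x) = act\<Gamma> \<gamma> (actG g x)"
  using act_pair[OF assms] by simp

lemma image_commute:
  assumes "g \<in> carrier G" "\<gamma> \<in> carrier \<Gamma>" "A \<subseteq> space M"
  shows "actG g ` act\<Gamma> \<gamma> ` A = act\<Gamma> \<gamma> ` actG g ` A"
  using act_commute[OF assms(1,2)] assms(3) unfolding image_image by (intro image_cong) auto

lemma translate_disjoint:
  assumes "g \<in> carrier G" "L \<subseteq> carrier \<Gamma>" "A \<subseteq> space M" "disjoint_family_on (\<lambda>\<gamma>. act\<Gamma> \<gamma> ` A) L"
  shows "disjoint_family_on (\<lambda>\<gamma>. act\<Gamma> \<gamma> ` actG g ` A) L"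
proof -
  have "act\<Gamma> a ` actG g ` A \<inter> act\<Gamma> b ` actG g ` A = {}" if "a \<in> L" "b \<in> L" "a \<noteq> b" for a b
  proof -
    have ab: "a \<in> carrier \<Gamma>" "b \<in> carrier \<Gamma>" using that assms(2) by auto
    have "actG g ` act\<Gamma> a ` A \<inter> actG g ` act\<Gamma> b ` A = actG g ` (act\<Gamma> a ` A \<inter> act\<Gamma> b ` A)"
      using ab assms act\<Gamma>.image_subset
      by (intro inj_on_image_Int[OF actG.inj_prop[OF assms(1)], symmetric]) auto
    also have "act\<Gamma> a ` A \<inter> act\<Gamma> b ` A = {}"
      using assms(4) that by (auto simp: disjoint_family_on_def)
    finally show ?thesis
      using image_commute[OF assms(1)] ab assms(3) by simp
  qed
  then show ?thesis by (auto simp: disjoint_family_on_def)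
qed

lemma translate_cover:
  assumes "g \<in> carrier G" "L \<subseteq> carrier \<Gamma>" "A \<subseteq> space M" "(\<Union>\<gamma>\<in>L. act\<Gamma> \<gamma> ` A) = space M"
  shows "(\<Union>\<gamma>\<in>L. act\<Gamma> \<gamma> ` actG g ` A) = space M"
proof -
  have "(\<Union>\<gamma>\<in>L. act\<Gamma> \<gamma> ` actG g ` A) = (\<Union>\<gamma>\<in>L. actG g ` act\<Gamma> \<gamma> ` A)"
    using image_commute[OF assms(1) subsetD[OF assms(2)] assms(3)] by simp
  also have "\<dots> = actG g ` (\<Union>\<gamma>\<in>L. act\<Gamma> \<gamma> ` A)" by blast
  also have "\<dots> = space M"
    unfolding assms(4) by (rule actG.surj_prop[OF assms(1)])
  finally show ?thesis .
qed

text \<open>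
  A translate under \<open>G\<close> of a fundamental domain for \<open>L\<close> is another fundamental domain for \<open>L\<close>. So the
  action of \<open>G\<close> on \<open>L\<close>-invariant sets preserves their measure modulo \<open>L\<close>, which is the measure of their
  intersection with any domain.
\<close>

lemma emeasure_of_translated_domain:
  assumes L: "subgroup L \<Gamma>" and g: "g \<in> carrier G"
    and D: "D \<in> sets M" "disjoint_family_on (\<lambda>\<gamma>. act\<Gamma> \<gamma> ` D) L" "(\<Union>\<gamma>\<in>L. act\<Gamma> \<gamma> ` D) = space M"
    and B: "B \<in> sets M" "\<And>l. l \<in> L \<Longrightarrow> act\<Gamma> l ` B = B"
  shows "emeasure M (actG g ` D \<inter> B) = emeasure M (D \<inter> B)"
proof -
  interpret L: measure_preserving_action "\<Gamma>\<lparr>carrier := L\<rparr>" M act\<Gamma>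
    by (rule action_of_subgroup_\<Gamma>[OF L])
  have D_space: "D \<subseteq> space M" using D(1) by (rule sets.sets_into_space)
  have L_sub: "L \<subseteq> carrier \<Gamma>" using L by (rule subgroup.subset)
  have "emeasure M (actG g ` D \<inter> B \<inter> (\<Union>\<gamma>\<in>L. act\<Gamma> \<gamma> ` D))
      = emeasure M (D \<inter> B \<inter> (\<Union>\<gamma>\<in>L. act\<Gamma> \<gamma> ` actG g ` D))"
    using L.emeasure_exchange[of "actG g ` D" D B] countable_subset[OF L_sub countable_\<Gamma>]
      translate_disjoint[OF g L_sub D_space D(2)] actG.sets_image[OF g D(1)] D B
    by simp
  then show ?thesis
    using sets.sets_into_space[OF B(1)]
    unfolding D(3) translate_cover[OF g L_sub D_space D(3)] by (simp add: Int_absorb2 le_infI2)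
qed

lemma translate_subgroup_disjoint:
  assumes "disjoint_family_on (\<lambda>\<gamma>. act\<Gamma> \<gamma> ` D) (carrier \<Gamma>)" "L \<subseteq> carrier \<Gamma>" "s \<in> carrier \<Gamma>" "D \<subseteq> space M"
  shows "disjoint_family_on (\<lambda>\<gamma>. act\<Gamma> \<gamma> ` act\<Gamma> s ` D) L"
proof -
  have eq: "act\<Gamma> \<gamma> ` act\<Gamma> s ` D = act\<Gamma> (\<gamma> \<otimes>\<^bsub>\<Gamma>\<^esub> s) ` D" if "\<gamma> \<in> L" for \<gamma>
  proof -
    have "\<gamma> \<in> carrier \<Gamma>" using that assms(2) by blast
    then show ?thesis
      using act\<Gamma>.act_mult[of \<gamma> s] assms(3,4) unfolding image_image by (intro image_cong) auto
  qed
  have "act\<Gamma> (a \<otimes>\<^bsub>\<Gamma>\<^esub> s) ` D \<inter> act\<Gamma> (b \<otimes>\<^bsub>\<Gamma>\<^esub> s) ` D = {}" if "a \<in> L" "b \<in> L" "a \<noteq> b" for a b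
  proof -
    have "a \<in> carrier \<Gamma>" "b \<in> carrier \<Gamma>" using that assms(2) by auto
    then have "a \<otimes>\<^bsub>\<Gamma>\<^esub> s \<noteq> b \<otimes>\<^bsub>\<Gamma>\<^esub> s" "a \<otimes>\<^bsub>\<Gamma>\<^esub> s \<in> carrier \<Gamma>" "b \<otimes>\<^bsub>\<Gamma>\<^esub> s \<in> carrier \<Gamma>"
      using that(3) assms(3) by auto
    then show ?thesis using assms(1) unfolding disjoint_family_on_def by blast
  qed
  then show ?thesis
    using eq by (auto simp: disjoint_family_on_def)
qed

end

section \<open>Small sets and centralizers\<close>

lemma (in group) subgroup_centralizer:
  assumes "H \<subseteq> carrier G"
  shows "subgroup (centralizer G H) G"
proof
  show "centralizer G H \<subseteq> carrier G" by (auto simp: centralizer_def)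
  show "\<one> \<in> centralizer G H" using assms by (auto simp: centralizer_def)
  fix x assume x: "x \<in> centralizer G H"
  have "inv x \<otimes> h = h \<otimes> inv x" if h: "h \<in> H" for h
  proof -
    have c: "x \<in> carrier G" "h \<in> carrier G" "x \<otimes> h = h \<otimes> x"
      using x h assms by (auto simp: centralizer_def)
    have "inv x \<otimes> h = inv x \<otimes> (h \<otimes> x) \<otimes> inv x"
      using c(1,2) by (simp add: m_assoc)
    also have "\<dots> = h \<otimes> inv x"
      using c(1,2) unfolding c(3)[symmetric] by (simp flip: m_assoc)
    finally show ?thesis .
  qed
  then show "inv x \<in> centralizer G H" using x by (auto simp: centralizer_def)
  fix y assume y: "y \<in> centralizer G H"
  have "x \<otimes> y \<otimes> h = h \<otimes> (x \<otimes> y)" if h: "h \<in> H" for h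
  proof -
    have c: "x \<in> carrier G" "y \<in> carrier G" "h \<in> carrier G" "x \<otimes> h = h \<otimes> x" "y \<otimes> h = h \<otimes> y"
      using x y h assms by (auto simp: centralizer_def)
    have "x \<otimes> y \<otimes> h = x \<otimes> h \<otimes> y"
      using c(1-3) by (simp add: m_assoc c(5))
    also have "\<dots> = h \<otimes> (x \<otimes> y)"
      using c(1-3) unfolding c(4) by (simp add: m_assoc)
    finally show ?thesis .
  qed
  then show "x \<otimes> y \<in> centralizer G H" using x y by (auto simp: centralizer_def)
qed

lemma (in group) double_coset_eq_image:
  assumes "L \<subseteq> carrier G" "s \<in> carrier G" "t \<in> carrier G"
  shows "s <# L #> t = (\<lambda>l. s \<otimes> l \<otimes> t) ` L"
  by (auto simp: l_coset_def r_coset_def)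

lemma (in group) small_relative_finite_UN:
  assumes "finite J" "\<And>j. j \<in> J \<Longrightarrow> small_relative G \<G> (A j)"
  shows "small_relative G \<G> (\<Union>j\<in>J. A j)"
proof -
  have "\<forall>j\<in>J. \<exists>F. finite F \<and> F \<subseteq> carrier G \<times> \<G> \<times> carrier G \<and> A j \<subseteq> (\<Union>(s, \<Lambda>, t) \<in> F. s <# \<Lambda> #> t)"
    using assms(2) by (simp add: small_relative_def)
  then obtain F where F: "\<And>j. j \<in> J \<Longrightarrow> finite (F j)"
    "\<And>j. j \<in> J \<Longrightarrow> F j \<subseteq> carrier G \<times> \<G> \<times> carrier G"
    "\<And>j. j \<in> J \<Longrightarrow> A j \<subseteq> (\<Union>(s, \<Lambda>, t) \<in> F j. s <# \<Lambda> #> t)"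
    by metis
  show ?thesis
    unfolding small_relative_def
  proof (intro exI[of _ "\<Union>j\<in>J. F j"] conjI)
    show "(\<Union>j\<in>J. A j) \<subseteq> (\<Union>(s, \<Lambda>, t) \<in> (\<Union>j\<in>J. F j). s <# \<Lambda> #> t)"
      using F(3) by blast
  qed (use F assms(1) in blast)+
qed

section \<open>Recurrence and measurable embeddings\<close>

context countable_ME_coupling
begin

lemma sigma_finite: "sigma_finite_measure M"
  using standard by (simp add: standard_measure_space_def)

text \<open>
  The mean ergodic argument is applied on the disjoint union of the quotients \<open>\<Sigma> / L i\<close>. This union is
  represented without forming quotients: as the set \<open>I \<times> \<Sigma>\<close> with the \<open>\<sigma>\<close>-algebra \<open>S\<close> of those sets whose
  \<open>i\<close>-th slice is \<open>L i\<close>-invariant, and with the measure that restricts the \<open>i\<close>-th slice to a fundamental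
  domain \<open>W i\<close> for \<open>L i\<close>. On these sets \<open>H\<close> acts measure preservingly because it commutes with \<open>\<Gamma>\<close>. An
  \<open>H\<close>-invariant set of finite positive measure has a slice of positive measure, and the non-null slice
  witnesses the embedding into the corresponding subgroup. Treating all \<open>i\<close> at once matters: the
  recurrence hypothesis does not say which \<open>i\<close> contributes to which \<open>h\<close>.
\<close>

lemma embeds_of_recurrent_sections:
  fixes L :: "'i \<Rightarrow> 'c set" and V U :: "'i \<Rightarrow> 'x set"
  assumes "finite I" and H: "subgroup H G"
    and L: "\<And>i. i \<in> I \<Longrightarrow> subgroup (L i) \<Gamma>"
    and V: "\<And>i. i \<in> I \<Longrightarrow> V i \<in> sets M" "\<And>i. i \<in> I \<Longrightarrow> emeasure M (V i) < \<infinity>"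
      "\<And>i. i \<in> I \<Longrightarrow> disjoint_family_on (\<lambda>l. act\<Gamma> l ` V i) (L i)"
    and U: "\<And>i. i \<in> I \<Longrightarrow> U i \<in> sets M" "\<And>i. i \<in> I \<Longrightarrow> emeasure M (U i) < \<infinity>"
      "\<And>i. i \<in> I \<Longrightarrow> disjoint_family_on (\<lambda>l. act\<Gamma> l ` U i) (L i)"
    and "0 < \<delta>"
    and recurrent: "\<And>h. h \<in> H \<Longrightarrow> \<delta> \<le> (\<Sum>i\<in>I. measure M (actG h ` V i \<inter> (\<Union>l\<in>L i. act\<Gamma> l ` U i)))"
  shows "\<exists>i\<in>I. measurably_embeds G M \<phi> H (L i)"
proof -
  interpret M: sigma_finite_measure M by (rule sigma_finite)
  have act_L: "measure_preserving_action (\<Gamma>\<lparr>carrier := L i\<rparr>) M act\<Gamma>" if "i \<in> I" for i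
    by (rule action_of_subgroup_\<Gamma>[OF L[OF that]])
  have L_sub: "L i \<subseteq> carrier \<Gamma>" if "i \<in> I" for i
    using L[OF that] by (rule subgroup.subset)
  have L_countable: "countable (L i)" if "i \<in> I" for i
    using countable_subset[OF L_sub[OF that] countable_\<Gamma>] .
  have L_closed: "act\<Gamma> l x \<in> space M" if "i \<in> I" "l \<in> L i" "x \<in> space M" for i l x
    using act\<Gamma>.act_closed L_sub[OF that(1)] that(2,3) by blast
  have H_sub: "H \<subseteq> carrier G" using H by (rule subgroup.subset)
  define sat where "sat i A = (\<Union>l\<in>L i. act\<Gamma> l ` A)" for i A
  have sat_eq: "sat i = measure_preserving_action.saturation (\<Gamma>\<lparr>carrier := L i\<rparr>) act\<Gamma>" if "i \<in> I" for i
    unfolding sat_def measure_preserving_action.saturation_def[OF act_L[OF that]] by simp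
  have sat_sets: "sat i A \<in> sets M" if "i \<in> I" "A \<in> sets M" for i A
    unfolding sat_eq[OF that(1)]
    using measure_preserving_action.sets_saturation[OF act_L[OF that(1)] _ that(2)] L_countable[OF that(1)] by simp
  have sat_iff: "act\<Gamma> l x \<in> sat i A \<longleftrightarrow> x \<in> sat i A" if "i \<in> I" "A \<subseteq> space M" "l \<in> L i" "x \<in> space M" for i A l x
    unfolding sat_eq[OF that(1)]
    using measure_preserving_action.mem_saturation_iff[OF act_L[OF that(1)] that(2) _ that(4)] that(3) by simp

  have "\<exists>\<rho>. \<forall>i\<in>I. \<rho> i \<in> measurable M (count_space (L i)) \<and>
      (\<forall>l\<in>L i. \<forall>x\<in>space M. \<rho> i (act\<Gamma> l x) = l \<otimes>\<^bsub>\<Gamma>\<^esub> \<rho> i x)"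
  proof (intro bchoice ballI)
    fix i assume "i \<in> I"
    obtain D where "fundamental_domain M (carrier \<Gamma>) act\<Gamma> (space M) D"
      using finite_domain_\<Gamma> by blast
    then show "\<exists>\<rho>. \<rho> \<in> measurable M (count_space (L i)) \<and>
        (\<forall>l\<in>L i. \<forall>x\<in>space M. \<rho> (act\<Gamma> l x) = l \<otimes>\<^bsub>\<Gamma>\<^esub> \<rho> x)"
      using act\<Gamma>.equivariant_map_to_subgroup[OF countable_\<Gamma> _ L[OF \<open>i \<in> I\<close>]] by metis
  qed
  then obtain \<rho> where \<rho>: "\<And>i. i \<in> I \<Longrightarrow> \<rho> i \<in> measurable M (count_space (L i))"
    and \<rho>_equi: "\<And>i l x. i \<in> I \<Longrightarrow> l \<in> L i \<Longrightarrow> x \<in> space M \<Longrightarrow> \<rho> i (act\<Gamma> l x) = l \<otimes>\<^bsub>\<Gamma>\<^esub> \<rho> i x"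
    by blast
  define W where "W i = {x \<in> space M. \<rho> i x = \<one>\<^bsub>\<Gamma>\<^esub>}" for i
  have domain: "fundamental_domain M (L i) act\<Gamma> B (B \<inter> W i)"
    if "i \<in> I" "B \<in> sets M" "\<And>l x. l \<in> L i \<Longrightarrow> x \<in> space M \<Longrightarrow> act\<Gamma> l x \<in> B \<longleftrightarrow> x \<in> B" for i B
  proof -
    have "B \<inter> W i = {x \<in> B. \<rho> i x = \<one>\<^bsub>\<Gamma>\<^esub>}"
      using sets.sets_into_space[OF that(2)] by (auto simp: W_def)
    then show ?thesis
      using measure_preserving_action.fundamental_domain_of_equivariant_map[OF act_L[OF that(1)], of "\<rho> i" B]
        L_countable[OF that(1)] \<rho>[OF that(1)] \<rho>_equi[OF that(1)] that(2,3) by simp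
  qed
  have W: "fundamental_domain M (L i) act\<Gamma> (space M) (W i)" if "i \<in> I" for i
    using domain[OF that, of "space M"] act\<Gamma>.act_closed L_sub[OF that] by (auto simp: W_def Int_def)
  have W_sets: "W i \<in> sets M" if "i \<in> I" for i
    using W[OF that] by (simp add: fundamental_domain_def)

  define P where "P = count_space I \<Otimes>\<^sub>M M"
  have space_P: "space P = I \<times> space M" by (simp add: P_def space_pair_measure)
  have Sigma_sets: "Sigma I C \<in> sets P" if "\<And>i. i \<in> I \<Longrightarrow> C i \<in> sets M" for C
  proof -
    have "Sigma I C = (\<Union>i\<in>I. {i} \<times> C i)" by auto
    then show ?thesis
      using \<open>finite I\<close> that by (auto simp: P_def intro!: sets.finite_UN)
  qed
  have slice_sets: "Pair i -` B \<in> sets M" if "B \<in> sets P" for i B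
    using that unfolding P_def by (rule sets_Pair1)
  define S where "S = {B \<in> sets P. \<forall>i\<in>I. \<forall>l\<in>L i. \<forall>x\<in>space M. (i, act\<Gamma> l x) \<in> B \<longleftrightarrow> (i, x) \<in> B}"
  have S_sets: "B \<in> sets P" if "B \<in> S" for B using that by (simp add: S_def)
  have "sigma_algebra (space P) S"
    unfolding sigma_algebra_iff2
  proof (intro conjI ballI allI impI)
    show "S \<subseteq> Pow (space P)" using sets.sets_into_space by (auto simp: S_def)
    show "{} \<in> S" by (simp add: S_def)
    show "space P - B \<in> S" if "B \<in> S" for B
      using that act\<Gamma>.act_closed L_sub sets.compl_sets[of B P] by (auto simp: S_def space_P)
    show "(\<Union>n. B n) \<in> S" if "range B \<subseteq> S" for B :: "nat \<Rightarrow> _"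
      using that by (auto simp: S_def subset_eq image_subset_iff)
  qed
  then have sets_sub: "sets (sigma (space P) S) = S"
    by (rule sigma_algebra.sets_measure_of_eq)
  define Q where "Q = density P (indicator (Sigma I W))"
  define N where "N = restr_to_subalg Q (sigma (space P) S)"
  have subalg: "Conditional_Expectation.subalgebra Q (sigma (space P) S)"
    using S_sets by (auto simp: Conditional_Expectation.subalgebra_def sets_sub Q_def space_measure_of_conv)
  have sets_N: "sets N = S"
    unfolding N_def sets_restr_to_subalg[OF subalg] sets_sub ..
  have space_N: "space N = I \<times> space M"
    unfolding N_def space_restr_to_subalg by (simp add: Q_def space_P)
  have emeasure_N: "emeasure N B = (\<Sum>i\<in>I. emeasure M (Pair i -` B \<inter> W i))" if B: "B \<in> S" for B
  proof -
    have W_P: "Sigma I W \<in> sets P" using Sigma_sets W_sets by blast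
    have "emeasure N B = emeasure Q B"
      unfolding N_def by (rule emeasure_restr_to_subalg[OF subalg]) (simp add: sets_sub B)
    also have "\<dots> = (\<integral>\<^sup>+p. indicator (Sigma I W) p * indicator B p \<partial>P)"
      unfolding Q_def using W_P S_sets[OF B] by (intro emeasure_density) auto
    also have "\<dots> = (\<integral>\<^sup>+p. indicator (Sigma I W \<inter> B) p \<partial>P)"
      by (simp add: indicator_inter_arith)
    also have "\<dots> = emeasure P (Sigma I W \<inter> B)"
      using W_P S_sets[OF B] by (intro nn_integral_indicator) auto
    also have "\<dots> = (\<integral>\<^sup>+i. emeasure M (Pair i -` (Sigma I W \<inter> B)) \<partial>count_space I)"
      using W_P S_sets[OF B] unfolding P_def by (intro M.emeasure_pair_measure_alt) auto
    also have "\<dots> = (\<Sum>i\<in>I. emeasure M (Pair i -` (Sigma I W \<inter> B)))"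
      by (rule nn_integral_count_space_finite[OF \<open>finite I\<close>])
    also have "\<dots> = (\<Sum>i\<in>I. emeasure M (Pair i -` B \<inter> W i))"
      by (intro sum.cong refl arg_cong[where f = "emeasure M"]) auto
    finally show ?thesis .
  qed
  have slice_inv: "act\<Gamma> l ` (Pair i -` B) = Pair i -` B" if "B \<in> S" "i \<in> I" "l \<in> L i" for B i l
    using that L_sub[OF that(2)] sets.sets_into_space[OF slice_sets[OF S_sets[OF that(1)]]]
    by (intro act\<Gamma>.image_eq_self) (auto simp: S_def)
  have Sigma_S: "Sigma I C \<in> S"
    if "\<And>i. i \<in> I \<Longrightarrow> C i \<in> sets M"
      "\<And>i l x. i \<in> I \<Longrightarrow> l \<in> L i \<Longrightarrow> x \<in> space M \<Longrightarrow> act\<Gamma> l x \<in> C i \<longleftrightarrow> x \<in> C i" for C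
    using Sigma_sets[OF that(1)] that(2) by (auto simp: S_def)
  have slice_Sigma: "Pair i -` Sigma I C = C i" if "i \<in> I" for i C
    using that by auto

  define T where "T h = (\<lambda>p :: 'i \<times> 'x. (fst p, actG h (snd p)))" for h
  have T_P: "T h \<in> measurable P P" if "h \<in> H" for h
  proof -
    note [measurable] = actG.measurable_action[OF subsetD[OF H_sub that]]
    show ?thesis unfolding T_def P_def by measurable
  qed
  have T_pre: "T h -` B \<inter> space N \<in> S" if "h \<in> H" "B \<in> S" for h B
  proof -
    have "T h -` B \<inter> space P \<in> sets P"
      using measurable_sets[OF T_P[OF that(1)] S_sets[OF that(2)]] .
    moreover have "(i, actG h (act\<Gamma> l x)) \<in> B \<longleftrightarrow> (i, actG h x) \<in> B"
      if "i \<in> I" "l \<in> L i" "x \<in> space M" for i l x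
    proof -
      have hl: "h \<in> carrier G" "l \<in> carrier \<Gamma>"
        using \<open>h \<in> H\<close> H_sub L_sub[OF that(1)] that(2) by auto
      show ?thesis
        unfolding act_commute[OF hl that(3)] using \<open>B \<in> S\<close> that actG.act_closed[OF hl(1) that(3)]
        by (simp add: S_def)
    qed
    ultimately show ?thesis
      using L_closed by (auto simp: S_def space_N space_P T_def)
  qed
  have T_meas: "T h \<in> measurable N N" if "h \<in> H" for h
  proof (rule measurableI)
    show "T h p \<in> space N" if "p \<in> space N" for p
      using that \<open>h \<in> H\<close> H_sub actG.act_closed by (auto simp: space_N T_def)
    show "T h -` B \<inter> space N \<in> sets N" if "B \<in> sets N" for B
      using T_pre[OF \<open>h \<in> H\<close>] that by (simp add: sets_N)
  qed
  have T_distr: "distr N N (T h) = N" if "h \<in> H" for h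
  proof (rule measure_eqI)
    have hG: "h \<in> carrier G" using that H_sub by auto
    fix B assume "B \<in> sets (distr N N (T h))"
    then have B: "B \<in> S" by (simp add: sets_N)
    have "emeasure (distr N N (T h)) B = emeasure N (T h -` B \<inter> space N)"
      using T_meas[OF that] B by (intro emeasure_distr) (auto simp: sets_N)
    also have "\<dots> = (\<Sum>i\<in>I. emeasure M (Pair i -` (T h -` B \<inter> space N) \<inter> W i))"
      by (rule emeasure_N[OF T_pre[OF that B]])
    also have "\<dots> = (\<Sum>i\<in>I. emeasure M (Pair i -` B \<inter> W i))"
    proof (rule sum.cong[OF refl])
      fix i assume i: "i \<in> I"
      let ?B = "Pair i -` B" and ?C = "Pair i -` (T h -` B \<inter> space N)"
      have B_space: "?B \<subseteq> space M"
        using sets.sets_into_space[OF slice_sets[OF S_sets[OF B]]] .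
      have C_space: "?C \<subseteq> space M" by (auto simp: space_N)
      have BC: "actG h ` ?C = ?B"
      proof -
        have "x \<in> actG h ` ?C \<longleftrightarrow> x \<in> ?B" if x: "x \<in> space M" for x
          using actG.mem_image_iff[OF hG C_space x] actG.act_inv_cancel(1)[OF hG x]
            actG.act_closed[of "inv\<^bsub>G\<^esub> h" x] hG x i
          by (auto simp: T_def space_N)
        then show ?thesis
          using B_space actG.image_subset[OF hG C_space] by blast
      qed
      have "emeasure M (?C \<inter> W i) = emeasure M (actG h ` (?C \<inter> W i))"
        using slice_sets[OF S_sets[OF T_pre[OF that B]]] W_sets[OF i]
        by (intro actG.emeasure_image[OF hG, symmetric]) auto
      also have "actG h ` (?C \<inter> W i) = actG h ` W i \<inter> ?B"
        using C_space sets.sets_into_space[OF W_sets[OF i]] unfolding BC[symmetric]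
        by (subst inj_on_image_Int[OF actG.inj_prop[OF hG]]) auto
      also have "emeasure M (actG h ` W i \<inter> ?B) = emeasure M (W i \<inter> ?B)"
        using W[OF i] slice_inv[OF B i] slice_sets[OF S_sets[OF B]]
        by (intro emeasure_of_translated_domain[OF L[OF i] hG]) (auto simp: fundamental_domain_def)
      finally show "emeasure M (?C \<inter> W i) = emeasure M (?B \<inter> W i)"
        by (simp add: Int_commute)
    qed
    also have "\<dots> = emeasure N B"
      by (rule emeasure_N[OF B, symmetric])
    finally show "emeasure (distr N N (T h)) B = emeasure N B" .
  qed simp

  \<comment> \<open>Sets with disjoint translates embed in the quotient, so their saturation has the same measure there.\<close>
  have sat_measure: "emeasure M (sat i A \<inter> B \<inter> W i) = emeasure M (A \<inter> B)"
    if "i \<in> I" "A \<in> sets M" "disjoint_family_on (\<lambda>l. act\<Gamma> l ` A) (L i)"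
      "B \<in> sets M" "\<And>l. l \<in> L i \<Longrightarrow> act\<Gamma> l ` B = B" for i A B
    unfolding sat_eq[OF that(1)]
    using measure_preserving_action.emeasure_saturation[OF act_L[OF that(1)], of A "W i" B]
      W[OF that(1)] L_countable[OF that(1)] that by simp
  have sat_finite: "emeasure N (Sigma I (\<lambda>i. sat i (A i))) < \<infinity>" "Sigma I (\<lambda>i. sat i (A i)) \<in> S"
    if A: "\<And>i. i \<in> I \<Longrightarrow> A i \<in> sets M" "\<And>i. i \<in> I \<Longrightarrow> emeasure M (A i) < \<infinity>"
      "\<And>i. i \<in> I \<Longrightarrow> disjoint_family_on (\<lambda>l. act\<Gamma> l ` A i) (L i)" for A
  proof -
    show S: "Sigma I (\<lambda>i. sat i (A i)) \<in> S"
      using A(1) by (intro Sigma_S sat_sets sat_iff sets.sets_into_space)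
    have "emeasure N (Sigma I (\<lambda>i. sat i (A i))) = (\<Sum>i\<in>I. emeasure M (A i))"
      unfolding emeasure_N[OF S]
    proof (rule sum.cong[OF refl])
      fix i assume i: "i \<in> I"
      have sp: "act\<Gamma> l ` space M = space M" if "l \<in> L i" for l
        using L_sub[OF i] that by (intro act\<Gamma>.surj_prop) auto
      have "emeasure M (Pair i -` Sigma I (\<lambda>i. sat i (A i)) \<inter> W i) = emeasure M (sat i (A i) \<inter> space M \<inter> W i)"
        using sets.sets_into_space[OF sat_sets[OF i A(1)[OF i]]] by (simp add: slice_Sigma[OF i] Int_absorb2)
      also have "\<dots> = emeasure M (A i \<inter> space M)"
        using A i sp by (intro sat_measure) auto
      also have "\<dots> = emeasure M (A i)"
        using sets.sets_into_space[OF A(1)[OF i]] by (simp add: Int_absorb2)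
      finally show "emeasure M (Pair i -` Sigma I (\<lambda>i. sat i (A i)) \<inter> W i) = emeasure M (A i)" .
    qed
    then show "emeasure N (Sigma I (\<lambda>i. sat i (A i))) < \<infinity>"
      using A(2) ennreal_sum_less_top[OF \<open>finite I\<close>, of "\<lambda>i. emeasure M (A i)"] by simp
  qed
  let ?A = "Sigma I (\<lambda>i. sat i (V i))" and ?E = "Sigma I (\<lambda>i. sat i (U i))"
  have rec_N: "\<delta> \<le> measure N ({p \<in> space N. T h p \<in> ?A} \<inter> ?E)" if h: "h \<in> H" for h
  proof -
    let ?h = "inv\<^bsub>G\<^esub> h"
    have h': "?h \<in> H" "?h \<in> carrier G" "h \<in> carrier G"
      using h H_sub subgroup.m_inv_closed[OF H] by auto
    have V_space: "V i \<subseteq> space M" if "i \<in> I" for i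
      using sets.sets_into_space[OF V(1)[OF that]] .
    \<comment> \<open>Applying T h backwards translates by the inverse of h, which again lies in H.\<close>
    have eq: "{p \<in> space N. T h p \<in> ?A} \<inter> ?E = Sigma I (\<lambda>i. sat i (actG ?h ` V i) \<inter> sat i (U i))"
    proof -
      have "actG h x \<in> sat i (V i) \<longleftrightarrow> x \<in> sat i (actG ?h ` V i)" if i: "i \<in> I" and x: "x \<in> space M" for i x
      proof -
        have "sat i (actG ?h ` V i) = actG ?h ` sat i (V i)"
          using image_commute[OF h'(2) subsetD[OF L_sub[OF i]] V_space[OF i]] by (simp add: sat_def image_UN)
        then show ?thesis
          using actG.mem_image_iff[OF h'(2) sets.sets_into_space[OF sat_sets[OF i V(1)[OF i]]] x] h' by simp
      qed
      moreover have "x \<in> space M" if "i \<in> I" "x \<in> sat i (U i)" for i x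
        using sets.sets_into_space[OF sat_sets[OF that(1) U(1)[OF that(1)]]] that(2) by blast
      ultimately show ?thesis
        by (auto simp: space_N T_def)
    qed
    have hV: "actG ?h ` V i \<in> sets M" if "i \<in> I" for i
      using V(1)[OF that] h' by (intro actG.sets_image) auto
    have hV_space: "actG ?h ` V i \<subseteq> space M" if "i \<in> I" for i
      using sets.sets_into_space[OF hV[OF that]] .
    have U_space: "U i \<subseteq> space M" if "i \<in> I" for i
      using sets.sets_into_space[OF U(1)[OF that]] .
    have S: "Sigma I (\<lambda>i. sat i (actG ?h ` V i) \<inter> sat i (U i)) \<in> S"
      by (intro Sigma_S sets.Int sat_sets hV U(1)) (simp_all add: sat_iff hV_space U_space)
    have "emeasure N ({p \<in> space N. T h p \<in> ?A} \<inter> ?E)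
        = (\<Sum>i\<in>I. emeasure M (actG ?h ` V i \<inter> sat i (U i)))"
      unfolding eq emeasure_N[OF S]
    proof (rule sum.cong[OF refl])
      fix i assume i: "i \<in> I"
      have inv: "act\<Gamma> l ` sat i (U i) = sat i (U i)" if "l \<in> L i" for l
        using that L_sub[OF i] sat_iff[OF i U_space[OF i] that] sets.sets_into_space[OF sat_sets[OF i U(1)[OF i]]]
        by (intro act\<Gamma>.image_eq_self) auto
      show "emeasure M (Pair i -` (Sigma I (\<lambda>i. sat i (actG ?h ` V i) \<inter> sat i (U i))) \<inter> W i)
          = emeasure M (actG ?h ` V i \<inter> sat i (U i))"
        unfolding slice_Sigma[OF i]
        using translate_disjoint[OF h'(2) L_sub[OF i] V_space[OF i] V(3)[OF i]]
        by (intro sat_measure i hV sat_sets U inv)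
    qed
    also have "\<dots> = (\<Sum>i\<in>I. ennreal (measure M (actG ?h ` V i \<inter> sat i (U i))))"
    proof (rule sum.cong[OF refl])
      fix i assume i: "i \<in> I"
      have "emeasure M (actG ?h ` V i \<inter> sat i (U i)) \<le> emeasure M (actG ?h ` V i)"
        using hV[OF i] by (intro emeasure_mono) auto
      also have "\<dots> < \<infinity>"
        using actG.emeasure_image[OF h'(2) V(1)[OF i]] V(2)[OF i] by simp
      finally show "emeasure M (actG ?h ` V i \<inter> sat i (U i)) = ennreal (measure M (actG ?h ` V i \<inter> sat i (U i)))"
        by (intro emeasure_eq_ennreal_measure) auto
    qed
    also have "\<dots> = ennreal (\<Sum>i\<in>I. measure M (actG ?h ` V i \<inter> sat i (U i)))"
      by (rule sum_ennreal) simp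
    finally have "measure N ({p \<in> space N. T h p \<in> ?A} \<inter> ?E)
        = (\<Sum>i\<in>I. measure M (actG ?h ` V i \<inter> sat i (U i)))"
      by (simp add: measure_def sum_nonneg)
    then show ?thesis
      using recurrent[OF h'(1)] by (simp add: sat_def)
  qed
  have group_H: "group (G\<lparr>carrier := H\<rparr>)"
    by (rule G.subgroup_imp_group[OF H])
  obtain B where B: "B \<in> sets N" "0 < emeasure N B" "emeasure N B < \<infinity>"
    and B_inv: "\<And>h p. h \<in> H \<Longrightarrow> p \<in> space N \<Longrightarrow> T h p \<in> B \<longleftrightarrow> p \<in> B"
  proof (rule invariant_set_of_recurrence[OF group_H, of T N ?A ?E \<delta>])
    show "countable (carrier (G\<lparr>carrier := H\<rparr>))"
      using countable_subset[OF H_sub countable_G] by simp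
    show "T (h \<otimes>\<^bsub>G\<lparr>carrier := H\<rparr>\<^esub> k) p = T h (T k p)"
      if "h \<in> carrier (G\<lparr>carrier := H\<rparr>)" "k \<in> carrier (G\<lparr>carrier := H\<rparr>)" "p \<in> space N" for h k p
      using that subsetD[OF H_sub] actG.act_mult[of h k "snd p"] by (auto simp: T_def space_N)
    show "T \<one>\<^bsub>G\<lparr>carrier := H\<rparr>\<^esub> p = p" if "p \<in> space N" for p
      using that actG.act_one by (auto simp: T_def space_N)
    show "emeasure N ?A < \<infinity>" "?A \<in> sets N" "emeasure N ?E < \<infinity>" "?E \<in> sets N"
      using sat_finite[of V] sat_finite[of U] V U by (simp_all add: sets_N)
  qed (use T_meas T_distr rec_N \<open>0 < \<delta>\<close> that in auto)
  have BS: "B \<in> S" using B(1) by (simp add: sets_N)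
  obtain i where i: "i \<in> I" and pos: "emeasure M (Pair i -` B \<inter> W i) \<noteq> 0"
  proof -
    have "\<exists>i\<in>I. emeasure M (Pair i -` B \<inter> W i) \<noteq> 0"
    proof (rule ccontr)
      assume "\<not> ?thesis"
      then show False using B(2) unfolding emeasure_N[OF BS] by simp
    qed
    with that show ?thesis by blast
  qed
  let ?\<Omega> = "Pair i -` B"
  have fin: "emeasure M (?\<Omega> \<inter> W i) < \<infinity>"
    using B(3) \<open>finite I\<close> i unfolding emeasure_N[OF BS] by (auto simp: less_top[symmetric])
  have \<Omega>_sets: "?\<Omega> \<in> sets M" using slice_sets[OF S_sets[OF BS]] .
  have \<Omega>_space: "?\<Omega> \<subseteq> space M" using sets.sets_into_space[OF \<Omega>_sets] .
  have "measurably_embeds G M \<phi> H (L i)"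
    unfolding measurably_embeds_def
  proof (intro bexI[OF _ \<Omega>_sets] conjI ballI exI)
    show "emeasure M ?\<Omega> \<noteq> 0"
      using pos emeasure_mono[of "?\<Omega> \<inter> W i" ?\<Omega> M] \<Omega>_sets by auto
    show "fundamental_domain M (L i) act\<Gamma> ?\<Omega> (?\<Omega> \<inter> W i)"
      using BS i by (intro domain[OF i \<Omega>_sets]) (auto simp: S_def)
    show "emeasure M (?\<Omega> \<inter> W i) < \<infinity>" by (rule fin)
    fix h l assume h: "h \<in> H" and l: "l \<in> L i"
    have hl: "h \<in> carrier G" "l \<in> carrier \<Gamma>" using h l H_sub L_sub[OF i] by auto
    have "actG h ` ?\<Omega> = ?\<Omega>"
      using B_inv[OF h] i by (intro actG.image_eq_self[OF hl(1) \<Omega>_space]) (auto simp: T_def space_N)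
    moreover have "\<phi> (h, l) ` ?\<Omega> = actG h ` act\<Gamma> l ` ?\<Omega>"
      unfolding image_image using act_pair(1)[OF hl] \<Omega>_space by (intro image_cong) auto
    ultimately show "\<phi> (h, l) ` ?\<Omega> = ?\<Omega>"
      using slice_inv[OF BS i l] by simp
  qed
  with i show ?thesis by blast
qed

text \<open>
  Translating by \<open>s\<^sup>-\<^sup>1\<close> turns the part of \<open>h D\<close> inside the union of \<open>\<gamma> D\<close> over \<open>\<gamma>\<close> in \<open>s \<Lambda> t\<close> into the part of
  \<open>h s\<^sup>-\<^sup>1 D\<close> inside the \<open>\<Lambda>\<close>-saturation of \<open>t D\<close>. So recurrence to a small set of \<open>\<Gamma>\<close> is recurrence in
  the quotients \<open>\<Sigma> / \<Lambda>\<close>, without conjugating the subgroups.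
\<close>

lemma embeds_of_recurrence:
  assumes D: "fundamental_domain M (carrier \<Gamma>) act\<Gamma> (space M) D" and D_fin: "emeasure M D < \<infinity>"
    and H: "subgroup H G"
    and sub: "\<And>\<Lambda>. \<Lambda> \<in> \<G> \<Longrightarrow> subgroup \<Lambda> \<Gamma>"
    and F: "finite F" "F \<subseteq> carrier \<Gamma> \<times> \<G> \<times> carrier \<Gamma>"
    and "0 < \<delta>"
    and recurrent: "\<And>h. h \<in> H \<Longrightarrow>
      \<delta> \<le> measure M (actG h ` D \<inter> (\<Union>\<gamma>\<in>(\<Union>(s, \<Lambda>, t)\<in>F. s <#\<^bsub>\<Gamma>\<^esub> \<Lambda> #>\<^bsub>\<Gamma>\<^esub> t). act\<Gamma> \<gamma> ` D))"
  shows "\<exists>\<Lambda>\<in>\<G>. measurably_embeds G M \<phi> H \<Lambda>"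
proof -
  define a L b where "a = (fst :: 'c \<times> 'c set \<times> 'c \<Rightarrow> 'c)" and "L = (\<lambda>i :: 'c \<times> 'c set \<times> 'c. fst (snd i))"
    and "b = (\<lambda>i :: 'c \<times> 'c set \<times> 'c. snd (snd i))"
  have i: "a i \<in> carrier \<Gamma>" "L i \<in> \<G>" "b i \<in> carrier \<Gamma>" "subgroup (L i) \<Gamma>" "L i \<subseteq> carrier \<Gamma>" if "i \<in> F" for i
  proof -
    show "a i \<in> carrier \<Gamma>" "L i \<in> \<G>" "b i \<in> carrier \<Gamma>"
      using that F(2) by (auto simp: a_def L_def b_def)
    then show "subgroup (L i) \<Gamma>" "L i \<subseteq> carrier \<Gamma>"
      using sub subgroup.subset by blast+
  qed
  have D_sets: "D \<in> sets M" and disj: "disjoint_family_on (\<lambda>k. act\<Gamma> k ` D) (carrier \<Gamma>)"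
    using D by (auto simp: fundamental_domain_def)
  have D_space: "D \<subseteq> space M" using D_sets by (rule sets.sets_into_space)
  define R where "R i = (\<Union>l\<in>L i. act\<Gamma> (a i \<otimes>\<^bsub>\<Gamma>\<^esub> l \<otimes>\<^bsub>\<Gamma>\<^esub> b i) ` D)" for i
  have R_sets: "R i \<in> sets M" if "i \<in> F" for i
    unfolding R_def using i[OF that] countable_subset[OF _ countable_\<Gamma>] D_sets
    by (intro sets.countable_UN'' act\<Gamma>.sets_image) auto
  have union: "(\<Union>\<gamma>\<in>(\<Union>(s, \<Lambda>, t)\<in>F. s <#\<^bsub>\<Gamma>\<^esub> \<Lambda> #>\<^bsub>\<Gamma>\<^esub> t). act\<Gamma> \<gamma> ` D) = (\<Union>i\<in>F. R i)"
  proof -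
    have eq: "(\<Union>(s, \<Lambda>, t)\<in>F. s <#\<^bsub>\<Gamma>\<^esub> \<Lambda> #>\<^bsub>\<Gamma>\<^esub> t) = (\<Union>i\<in>F. (\<lambda>l. a i \<otimes>\<^bsub>\<Gamma>\<^esub> l \<otimes>\<^bsub>\<Gamma>\<^esub> b i) ` L i)"
    proof (rule SUP_cong[OF refl])
      fix j assume "j \<in> F"
      then show "(case j of (s, \<Lambda>, t) \<Rightarrow> s <#\<^bsub>\<Gamma>\<^esub> \<Lambda> #>\<^bsub>\<Gamma>\<^esub> t) = (\<lambda>l. a j \<otimes>\<^bsub>\<Gamma>\<^esub> l \<otimes>\<^bsub>\<Gamma>\<^esub> b j) ` L j"
        using \<Gamma>.double_coset_eq_image[of "L j" "a j" "b j"] i[of j]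
        by (simp add: a_def L_def b_def case_prod_beta)
    qed
    show ?thesis unfolding eq R_def by blast
  qed
  have "\<exists>i\<in>F. measurably_embeds G M \<phi> H (L i)"
  proof (rule embeds_of_recurrent_sections[OF F(1) H, of L "\<lambda>i. act\<Gamma> (inv\<^bsub>\<Gamma>\<^esub> a i) ` D" "\<lambda>i. act\<Gamma> (b i) ` D" \<delta>])
    fix h assume h: "h \<in> H"
    have hG: "h \<in> carrier G" using h H subgroup.mem_carrier by metis
    have "\<delta> \<le> measure M (\<Union>i\<in>F. actG h ` D \<inter> R i)"
      using recurrent[OF h] unfolding union by (simp only: Int_UN_distrib)
    also have "\<dots> \<le> (\<Sum>i\<in>F. measure M (actG h ` D \<inter> R i))"
      using F(1) R_sets D_sets actG.sets_image[OF hG] by (intro measure_UNION_le) auto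
    also have "\<dots> = (\<Sum>i\<in>F. measure M (actG h ` act\<Gamma> (inv\<^bsub>\<Gamma>\<^esub> a i) ` D \<inter> (\<Union>l\<in>L i. act\<Gamma> l ` act\<Gamma> (b i) ` D)))"
    proof (rule sum.cong[OF refl])
      fix j assume j: "j \<in> F"
      note ij = i[OF j]
      let ?V = "act\<Gamma> (inv\<^bsub>\<Gamma>\<^esub> a j) ` D" and ?U = "\<Union>l\<in>L j. act\<Gamma> l ` act\<Gamma> (b j) ` D"
      have V_sets: "?V \<in> sets M" using ij D_sets by (intro act\<Gamma>.sets_image) auto
      have hV_sets: "actG h ` ?V \<in> sets M" using V_sets by (intro actG.sets_image[OF hG])
      have U_sets: "?U \<in> sets M"
        using ij countable_subset[OF ij(5) countable_\<Gamma>] D_sets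
        by (intro sets.countable_UN'' act\<Gamma>.sets_image) auto
      have "act\<Gamma> (a j) ` actG h ` ?V = actG h ` act\<Gamma> (a j) ` ?V"
        using image_commute[OF hG ij(1) sets.sets_into_space[OF V_sets]] by simp
      also have "act\<Gamma> (a j) ` ?V = D"
        using act\<Gamma>.act_inv_cancel(1)[OF ij(1)] D_space by (force simp: image_iff subset_eq)
      finally have 1: "act\<Gamma> (a j) ` actG h ` ?V = actG h ` D" .
      have "act\<Gamma> (a j) ` act\<Gamma> l ` act\<Gamma> (b j) ` D = act\<Gamma> (a j \<otimes>\<^bsub>\<Gamma>\<^esub> l \<otimes>\<^bsub>\<Gamma>\<^esub> b j) ` D" if l: "l \<in> L j" for l
      proof -
        have "l \<in> carrier \<Gamma>" using l ij(5) by blast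
        then show ?thesis
          unfolding image_image using ij D_space act\<Gamma>.act_closed
          by (intro image_cong) (auto simp: act\<Gamma>.act_mult subset_eq)
      qed
      then have 2: "act\<Gamma> (a j) ` ?U = R j"
        by (simp add: image_UN R_def)
      have "act\<Gamma> (a j) ` (actG h ` ?V \<inter> ?U) = actG h ` D \<inter> R j"
        using inj_on_image_Int[OF act\<Gamma>.inj_prop[OF ij(1)], of "actG h ` ?V" ?U]
          sets.sets_into_space[OF hV_sets] sets.sets_into_space[OF U_sets]
        unfolding 1 2 by simp
      then have "emeasure M (actG h ` D \<inter> R j) = emeasure M (actG h ` ?V \<inter> ?U)"
        using act\<Gamma>.emeasure_image[OF ij(1), of "actG h ` ?V \<inter> ?U"] hV_sets U_sets by simp
      then show "measure M (actG h ` D \<inter> R j) = measure M (actG h ` ?V \<inter> ?U)"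
        by (simp add: measure_def)
    qed
    finally show "\<delta> \<le> (\<Sum>i\<in>F. measure M (actG h ` act\<Gamma> (inv\<^bsub>\<Gamma>\<^esub> a i) ` D \<inter> (\<Union>l\<in>L i. act\<Gamma> l ` act\<Gamma> (b i) ` D)))" .
  qed (use i D_sets D_fin \<open>0 < \<delta>\<close> translate_subgroup_disjoint[OF disj _ _ D_space] in
      \<open>auto simp: act\<Gamma>.emeasure_image act\<Gamma>.sets_image\<close>)
  then show ?thesis using i by blast
qed

lemma emeasure_domain_pos:
  assumes D: "fundamental_domain M (carrier \<Gamma>) act\<Gamma> (space M) D"
  shows "emeasure M D \<noteq> 0"
proof
  assume "emeasure M D = 0"
  then have "act\<Gamma> \<gamma> ` D \<in> null_sets M" if "\<gamma> \<in> carrier \<Gamma>" for \<gamma>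
    using D act\<Gamma>.emeasure_image[OF that, of D] act\<Gamma>.sets_image[OF that, of D]
    by (auto simp: fundamental_domain_def)
  then have "(\<Union>\<gamma>\<in>carrier \<Gamma>. act\<Gamma> \<gamma> ` D) \<in> null_sets M"
    by (intro null_sets_UN' countable_\<Gamma>) auto
  then show False
    using D nonnull by (auto simp: fundamental_domain_def)
qed

end

section \<open>Countably valued functions and distances of probability measures\<close>

text \<open>
  A function with countably many values on a set of finite measure takes only finitely many values up to
  small measure. This is what lets bi-exactness, which concerns one pair \<open>(s, t)\<close> at a time, be applied to
  a cocycle with infinitely many values.
\<close>

lemma finite_values_outside_small_set:
  assumes C: "countable C" and v [measurable]: "v \<in> measurable M (count_space C)"
    and D [measurable]: "D \<in> sets M" and fin: "emeasure M D < \<infinity>" and "0 < \<eta>"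
  obtains S where "finite S" "S \<subseteq> C" "emeasure M {x \<in> D. v x \<notin> S} < ennreal \<eta>"
proof -
  define S where "S n = {c \<in> C. to_nat_on C c < n}" for n
  define A where "A n = {x \<in> D. v x \<notin> S n}" for n
  have D_space: "D \<subseteq> space M" using D by (rule sets.sets_into_space)
  have A_sets: "A n \<in> sets M" for n
  proof -
    have "A n = D - (v -` S n \<inter> space M)" using D_space by (auto simp: A_def)
    then show ?thesis using measurable_sets[OF v, of "S n"] by (auto simp: S_def)
  qed
  have "(\<lambda>n. emeasure M (A n)) \<longlonglongrightarrow> emeasure M (\<Inter>n. A n)"
  proof (rule Lim_emeasure_decseq)
    show "decseq A" by (auto simp: decseq_def A_def S_def)
    show "emeasure M (A n) \<noteq> \<infinity>" for n
      using emeasure_mono[of "A n" D M] fin by (auto simp: A_def top_unique)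
  qed (use A_sets in auto)
  moreover have "(\<Inter>n. A n) = {}"
  proof -
    have "x \<notin> A (Suc (to_nat_on C (v x)))" if "x \<in> D" for x
      using that measurable_space[OF v, of x] D_space by (auto simp: A_def S_def)
    then show ?thesis by (auto simp: A_def)
  qed
  ultimately have "(\<lambda>n. emeasure M (A n)) \<longlonglongrightarrow> 0" by simp
  then have "\<forall>\<^sub>F n in sequentially. emeasure M (A n) < ennreal \<eta>"
    using \<open>0 < \<eta>\<close> by (intro order_tendstoD(2)) auto
  then obtain n where "emeasure M (A n) < ennreal \<eta>"
    by (auto simp: eventually_sequentially)
  moreover have "finite (S n)"
  proof (rule inj_on_finite)
    show "inj_on (to_nat_on C) (S n)"
      using inj_on_to_nat_on[OF C] by (rule inj_on_subset) (auto simp: S_def)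
    show "to_nat_on C ` S n \<subseteq> {..<n}" by (auto simp: S_def)
  qed simp
  ultimately show ?thesis
    using that[of "S n"] by (auto simp: A_def S_def)
qed

lemma nn_integral_pmf_diff_eq_infsum:
  fixes p q :: "'a pmf"
  shows "(\<integral>\<^sup>+y. ennreal \<bar>pmf p y - pmf q y\<bar> \<partial>count_space A)
       = ennreal (infsum (\<lambda>y. \<bar>pmf p y - pmf q y\<bar>) A)"
proof -
  have "Infinite_Set_Sum.abs_summable_on (\<lambda>y. pmf p y - pmf q y) A"
    by (intro abs_summable_on_diff pmf_abs_summable)
  then have s: "Infinite_Set_Sum.abs_summable_on (\<lambda>y. \<bar>pmf p y - pmf q y\<bar>) A"
    unfolding real_norm_def[symmetric] by (simp only: abs_summable_on_norm_iff)
  then show ?thesis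
    by (simp add: nn_integral_conv_infsetsum infsetsum_infsum)
qed

lemma nn_integral_pmf_eq_1:
  assumes "set_pmf p \<subseteq> A"
  shows "(\<integral>\<^sup>+y. ennreal (pmf p y) \<partial>count_space A) = 1"
proof -
  have "emeasure (measure_pmf p) A = 1"
    using assms by (intro measure_pmf.emeasure_eq_1_AE) (auto simp: AE_measure_pmf_iff)
  then show ?thesis by (simp add: nn_integral_pmf)
qed

lemma nn_integral_pmf_diff_le_2:
  fixes p q :: "'a pmf"
  shows "(\<integral>\<^sup>+y. ennreal \<bar>pmf p y - pmf q y\<bar> \<partial>count_space A) \<le> 2"
proof -
  have "(\<integral>\<^sup>+y. ennreal \<bar>pmf p y - pmf q y\<bar> \<partial>count_space A)
      \<le> (\<integral>\<^sup>+y. ennreal (pmf p y) + ennreal (pmf q y) \<partial>count_space A)"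
    by (intro nn_integral_mono) (auto simp: abs_le_iff simp flip: ennreal_plus intro!: ennreal_leI add_increasing add_increasing2)
  also have "\<dots> = emeasure (measure_pmf p) A + emeasure (measure_pmf q) A"
    by (simp add: nn_integral_add nn_integral_pmf)
  also have "\<dots> \<le> 1 + 1"
    by (intro add_mono measure_pmf.emeasure_le_1)
  finally show ?thesis by simp
qed

section \<open>Densities transported by a bi-exactness map\<close>

text \<open>
  Fixing \<open>D\<close> identifies \<open>\<Sigma>\<close> with \<open>D \<times> \<Gamma>\<close>, the second coordinate being \<open>\<pi>\<close>.
\<close>

locale ME_coupling_with_domain = countable_ME_coupling G \<Gamma> M \<phi>
  for G :: "('g, 'm) monoid_scheme" and \<Gamma> :: "('c, 'n) monoid_scheme"
    and M :: "'x measure" and \<phi> :: "'g \<times> 'c \<Rightarrow> 'x \<Rightarrow> 'x" +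
  fixes D :: "'x set" and \<pi> :: "'x \<Rightarrow> 'c"
  assumes D: "fundamental_domain M (carrier \<Gamma>) act\<Gamma> (space M) D"
    and D_fin: "emeasure M D < \<infinity>"
    and \<pi>: "\<pi> \<in> measurable M (count_space (carrier \<Gamma>))"
    and \<pi>_act: "\<And>\<gamma> x. \<gamma> \<in> carrier \<Gamma> \<Longrightarrow> x \<in> space M \<Longrightarrow> \<pi> (act\<Gamma> \<gamma> x) = \<gamma> \<otimes>\<^bsub>\<Gamma>\<^esub> \<pi> x"
    and \<pi>_one_iff: "\<And>x. x \<in> space M \<Longrightarrow> \<pi> x = \<one>\<^bsub>\<Gamma>\<^esub> \<longleftrightarrow> x \<in> D"
begin

lemma \<pi>_carrier: "x \<in> space M \<Longrightarrow> \<pi> x \<in> carrier \<Gamma>"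
  using measurable_space[OF \<pi>] by simp

lemma D_sets: "D \<in> sets M"
  using D by (simp add: fundamental_domain_def)

lemma D_space: "D \<subseteq> space M"
  using D_sets by (rule sets.sets_into_space)


text \<open>
  Up to inversion, this is the cocycle of the coupling extended to a \<open>\<Gamma>\<close>-invariant function on \<open>\<Sigma>\<close>: if
  \<open>x \<in> D\<close>, then \<open>g x\<close> lies in the translate of \<open>D\<close> by \<open>displacement g x\<close>.
\<close>

definition displacement :: "'g \<Rightarrow> 'x \<Rightarrow> 'c"
  where "displacement g x = inv\<^bsub>\<Gamma>\<^esub> \<pi> x \<otimes>\<^bsub>\<Gamma>\<^esub> \<pi> (actG g x)"

text \<open>
  In the coordinates \<open>\<gamma>\<^sup>-\<^sup>1 y\<close> with \<open>y \<in> D\<close>, this is the function \<open>(y, \<gamma>) \<mapsto> \<xi> y \<gamma>\<close>, where \<open>\<xi> y\<close> is the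
  probability measure that \<open>\<mu>\<close> assigns to the displacement of \<open>y\<close> under \<open>k\<close>.
\<close>

definition transported_density :: "('c \<Rightarrow> 'c pmf) \<Rightarrow> 'g \<Rightarrow> 'x \<Rightarrow> real"
  where "transported_density \<mu> k x = pmf (\<mu> (displacement k x)) (inv\<^bsub>\<Gamma>\<^esub> \<pi> x)"

lemma measurable_displacement:
  assumes g: "g \<in> carrier G"
  shows "displacement g \<in> measurable M (count_space (carrier \<Gamma>))"
proof -
  have 1: "(\<lambda>x. \<pi> (actG g x)) \<in> measurable M (count_space (carrier \<Gamma>))"
    using actG.measurable_action[OF g] \<pi> by (rule measurable_compose)
  have "(\<lambda>x. inv\<^bsub>\<Gamma>\<^esub> a \<otimes>\<^bsub>\<Gamma>\<^esub> \<pi> (actG g x)) \<in> measurable M (count_space (carrier \<Gamma>))" if "a \<in> carrier \<Gamma>" for a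
    using 1 by (rule measurable_compose) (use that in \<open>simp add: measurable_count_space_eq1\<close>)
  then show ?thesis
    unfolding displacement_def by (rule measurable_compose_countable'[OF _ \<pi> countable_\<Gamma>])
qed

lemma measurable_transported_density:
  assumes k: "k \<in> carrier G"
  shows "transported_density \<mu> k \<in> borel_measurable M"
  unfolding transported_density_def
proof (rule measurable_compose_countable'[OF _ \<pi> countable_\<Gamma>])
  fix a assume "a \<in> carrier \<Gamma>"
  show "(\<lambda>x. pmf (\<mu> (displacement k x)) (inv\<^bsub>\<Gamma>\<^esub> a)) \<in> borel_measurable M"
    using measurable_displacement[OF k] by (rule measurable_compose) simp
qed

lemma displacement_invariant:
  assumes g: "g \<in> carrier G" and \<gamma>: "\<gamma> \<in> carrier \<Gamma>" and x: "x \<in> space M"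
  shows "displacement g (act\<Gamma> \<gamma> x) = displacement g x"
proof -
  have gx: "actG g x \<in> space M" by (rule actG.act_closed[OF g x])
  have "displacement g (act\<Gamma> \<gamma> x) = inv\<^bsub>\<Gamma>\<^esub> (\<gamma> \<otimes>\<^bsub>\<Gamma>\<^esub> \<pi> x) \<otimes>\<^bsub>\<Gamma>\<^esub> (\<gamma> \<otimes>\<^bsub>\<Gamma>\<^esub> \<pi> (actG g x))"
    unfolding displacement_def by (simp add: act_commute g \<gamma> x gx \<pi>_act)
  also have "\<dots> = displacement g x"
  proof -
    have "inv\<^bsub>\<Gamma>\<^esub> \<gamma> \<otimes>\<^bsub>\<Gamma>\<^esub> (\<gamma> \<otimes>\<^bsub>\<Gamma>\<^esub> \<pi> (actG g x)) = \<pi> (actG g x)"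
      using \<gamma> \<pi>_carrier[OF gx] by (simp flip: \<Gamma>.m_assoc)
    then show ?thesis
      using \<gamma> \<pi>_carrier[OF x] \<pi>_carrier[OF gx] by (simp add: \<Gamma>.inv_mult_group \<Gamma>.m_assoc displacement_def)
  qed
  finally show ?thesis .
qed

text \<open>
  Along each orbit of \<open>\<Gamma>\<close> the density runs once through the values of a probability measure on \<open>\<Gamma>\<close>.
\<close>

lemma nn_integral_transported_density:
  assumes \<mu>: "\<forall>x \<in> carrier \<Gamma>. set_pmf (\<mu> x) \<subseteq> carrier \<Gamma>"
    and k: "k \<in> carrier G"
  shows "(\<integral>\<^sup>+x. ennreal (transported_density \<mu> k x) \<partial>M) = emeasure M D"
proof -
  have "(\<integral>\<^sup>+x. ennreal (transported_density \<mu> k x) \<partial>M)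
      = (\<integral>\<^sup>+x. (\<integral>\<^sup>+\<gamma>. ennreal (transported_density \<mu> k (act\<Gamma> \<gamma> x)) \<partial>count_space (carrier \<Gamma>)) * indicator D x \<partial>M)"
    by (intro act\<Gamma>.nn_integral_unfold[OF countable_\<Gamma> D]
        measurable_compose[OF measurable_transported_density[OF k] measurable_ennreal])
  also have "\<dots> = (\<integral>\<^sup>+x. indicator D x \<partial>M)"
  proof (rule nn_integral_cong)
    fix x assume x: "x \<in> space M"
    have "(\<integral>\<^sup>+\<gamma>. ennreal (transported_density \<mu> k (act\<Gamma> \<gamma> x)) \<partial>count_space (carrier \<Gamma>)) = 1" if "x \<in> D"
    proof -
      let ?p = "\<mu> (displacement k x)"
      have "displacement k x \<in> carrier \<Gamma>"
        using measurable_space[OF measurable_displacement[OF k] x] by simp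
      then have p: "set_pmf ?p \<subseteq> carrier \<Gamma>" using \<mu> by blast
      have "\<pi> x = \<one>\<^bsub>\<Gamma>\<^esub>" using \<pi>_one_iff[OF x] that by simp
      then have "(\<integral>\<^sup>+\<gamma>. ennreal (transported_density \<mu> k (act\<Gamma> \<gamma> x)) \<partial>count_space (carrier \<Gamma>))
          = (\<integral>\<^sup>+\<gamma>. ennreal (pmf ?p (inv\<^bsub>\<Gamma>\<^esub> \<gamma>)) \<partial>count_space (carrier \<Gamma>))"
        using x k by (intro nn_integral_cong)
          (simp add: transported_density_def displacement_invariant \<pi>_act)
      also have "\<dots> = (\<integral>\<^sup>+y. ennreal (pmf ?p y) \<partial>count_space (carrier \<Gamma>))"
      proof (rule nn_integral_bij_count_space)
        show "bij_betw (\<lambda>\<gamma>. inv\<^bsub>\<Gamma>\<^esub> \<gamma>) (carrier \<Gamma>) (carrier \<Gamma>)"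
          by (rule bij_betwI[where g = "\<lambda>\<gamma>. inv\<^bsub>\<Gamma>\<^esub> \<gamma>"]) auto
      qed
      also have "\<dots> = 1" by (rule nn_integral_pmf_eq_1[OF p])
      finally show ?thesis .
    qed
    then show "(\<integral>\<^sup>+\<gamma>. ennreal (transported_density \<mu> k (act\<Gamma> \<gamma> x)) \<partial>count_space (carrier \<Gamma>)) * indicator D x = indicator D x"
      by (simp add: indicator_def)
  qed
  also have "\<dots> = emeasure M D" using D_sets by simp
  finally show ?thesis .
qed

text \<open>
  This is where the centralizer enters. Because \<open>g\<close> and \<open>k\<close> commute, the displacement \<open>c\<close> of \<open>x\<close> under \<open>k\<close>
  changes to \<open>s c t\<close> when \<open>x\<close> is moved by \<open>g\<close>, where \<open>s\<close> and \<open>t\<close> come from the displacements under \<open>g\<close> of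
  \<open>x\<close> and of \<open>k x\<close>. The change of the density along the orbit of \<open>x\<close> is therefore exactly the distance of
  \<open>\<mu> (s c t)\<close> from the translate of \<open>\<mu> c\<close> by \<open>s\<close>, the quantity that bi-exactness controls.
\<close>

lemma transported_density_shift:
  assumes \<mu>: "\<forall>x \<in> carrier \<Gamma>. set_pmf (\<mu> x) \<subseteq> carrier \<Gamma>"
    and k: "k \<in> carrier G" and g: "g \<in> carrier G" and commute: "g \<otimes>\<^bsub>G\<^esub> k = k \<otimes>\<^bsub>G\<^esub> g"
    and x: "x \<in> space M" and \<pi>_one: "\<pi> x = \<one>\<^bsub>\<Gamma>\<^esub>"
  shows "(\<integral>\<^sup>+\<gamma>. ennreal \<bar>transported_density \<mu> k (actG g (act\<Gamma> \<gamma> x)) - transported_density \<mu> k (act\<Gamma> \<gamma> x)\<bar> \<partial>count_space (carrier \<Gamma>))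
    = (let s = inv\<^bsub>\<Gamma>\<^esub> displacement g x; t = displacement g (actG k x); c = displacement k x in
      (\<integral>\<^sup>+y. ennreal \<bar>pmf (\<mu> (s \<otimes>\<^bsub>\<Gamma>\<^esub> c \<otimes>\<^bsub>\<Gamma>\<^esub> t)) y - pmf (map_pmf (\<lambda>z. s \<otimes>\<^bsub>\<Gamma>\<^esub> z) (\<mu> c)) y\<bar> \<partial>count_space (carrier \<Gamma>)))"
proof -
  have sp: "actG g x \<in> space M" "actG k x \<in> space M" "actG g (actG k x) \<in> space M" "actG k (actG g x) \<in> space M"
    using g k x actG.act_closed by auto
  define a where "a = \<pi> (actG g x)"
  define c where "c = \<pi> (actG k x)"
  define b where "b = \<pi> (actG g (actG k x))"
  have carr: "a \<in> carrier \<Gamma>" "c \<in> carrier \<Gamma>" "b \<in> carrier \<Gamma>"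
    using sp \<pi>_carrier by (auto simp: a_def b_def c_def)
  have kg: "actG k (actG g x) = actG g (actG k x)"
    using actG.act_mult[OF g k x] actG.act_mult[OF k g x] commute by simp
  have da: "displacement g x = a" and dc: "displacement k x = c"
    using carr by (auto simp: displacement_def \<pi>_one a_def c_def)
  have dt: "displacement g (actG k x) = inv\<^bsub>\<Gamma>\<^esub> c \<otimes>\<^bsub>\<Gamma>\<^esub> b"
    by (simp add: displacement_def b_def c_def)
  have dg: "displacement k (actG g x) = inv\<^bsub>\<Gamma>\<^esub> a \<otimes>\<^bsub>\<Gamma>\<^esub> b"
    by (simp add: displacement_def a_def b_def kg)
  let ?s = "inv\<^bsub>\<Gamma>\<^esub> a"
  have sct: "?s \<otimes>\<^bsub>\<Gamma>\<^esub> c \<otimes>\<^bsub>\<Gamma>\<^esub> (inv\<^bsub>\<Gamma>\<^esub> c \<otimes>\<^bsub>\<Gamma>\<^esub> b) = ?s \<otimes>\<^bsub>\<Gamma>\<^esub> b"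
  proof -
    have "c \<otimes>\<^bsub>\<Gamma>\<^esub> (inv\<^bsub>\<Gamma>\<^esub> c \<otimes>\<^bsub>\<Gamma>\<^esub> b) = b"
      using carr by (simp flip: \<Gamma>.m_assoc)
    then show ?thesis using carr by (simp add: \<Gamma>.m_assoc)
  qed
  have map: "pmf (map_pmf (\<lambda>z. ?s \<otimes>\<^bsub>\<Gamma>\<^esub> z) (\<mu> c)) (?s \<otimes>\<^bsub>\<Gamma>\<^esub> y) = pmf (\<mu> c) y" if y: "y \<in> carrier \<Gamma>" for y
  proof (cases "y \<in> set_pmf (\<mu> c)")
    case True
    have "inj_on (\<lambda>z. ?s \<otimes>\<^bsub>\<Gamma>\<^esub> z) (set_pmf (\<mu> c))"
      using \<mu>[rule_format, OF carr(2)] carr by (auto simp: inj_on_def subset_eq)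
    then show ?thesis using True by (rule pmf_map_inj)
  next
    case False
    have "?s \<otimes>\<^bsub>\<Gamma>\<^esub> y \<notin> (\<lambda>z. ?s \<otimes>\<^bsub>\<Gamma>\<^esub> z) ` set_pmf (\<mu> c)"
      using \<mu>[rule_format, OF carr(2)] carr y False by (auto simp: subset_eq)
    then have "pmf (map_pmf (\<lambda>z. ?s \<otimes>\<^bsub>\<Gamma>\<^esub> z) (\<mu> c)) (?s \<otimes>\<^bsub>\<Gamma>\<^esub> y) = 0"
      by (simp add: pmf_eq_0_set_pmf)
    also have "\<dots> = pmf (\<mu> c) y" using False by (simp add: pmf_eq_0_set_pmf)
    finally show ?thesis .
  qed
  let ?d = "\<lambda>y. ennreal \<bar>pmf (\<mu> (?s \<otimes>\<^bsub>\<Gamma>\<^esub> b)) y - pmf (map_pmf (\<lambda>z. ?s \<otimes>\<^bsub>\<Gamma>\<^esub> z) (\<mu> c)) y\<bar>"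
  have "(\<integral>\<^sup>+\<gamma>. ennreal \<bar>transported_density \<mu> k (actG g (act\<Gamma> \<gamma> x)) - transported_density \<mu> k (act\<Gamma> \<gamma> x)\<bar> \<partial>count_space (carrier \<Gamma>))
      = (\<integral>\<^sup>+\<gamma>. ?d (?s \<otimes>\<^bsub>\<Gamma>\<^esub> inv\<^bsub>\<Gamma>\<^esub> \<gamma>) \<partial>count_space (carrier \<Gamma>))"
  proof (rule nn_integral_cong)
    fix \<gamma> assume "\<gamma> \<in> space (count_space (carrier \<Gamma>))"
    then have \<gamma>: "\<gamma> \<in> carrier \<Gamma>" by simp
    have "transported_density \<mu> k (act\<Gamma> \<gamma> x) = pmf (\<mu> c) (inv\<^bsub>\<Gamma>\<^esub> \<gamma>)"
      using \<gamma> by (simp add: transported_density_def displacement_invariant[OF k \<gamma> x] dc \<pi>_act x \<pi>_one)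
    moreover have "transported_density \<mu> k (actG g (act\<Gamma> \<gamma> x)) = pmf (\<mu> (?s \<otimes>\<^bsub>\<Gamma>\<^esub> b)) (?s \<otimes>\<^bsub>\<Gamma>\<^esub> inv\<^bsub>\<Gamma>\<^esub> \<gamma>)"
      using \<gamma> carr
      by (simp add: act_commute[OF g \<gamma> x] transported_density_def displacement_invariant[OF k \<gamma> sp(1)]
          dg \<pi>_act sp(1) a_def[symmetric] \<Gamma>.inv_mult_group)
    ultimately show "ennreal \<bar>transported_density \<mu> k (actG g (act\<Gamma> \<gamma> x)) - transported_density \<mu> k (act\<Gamma> \<gamma> x)\<bar> = ?d (?s \<otimes>\<^bsub>\<Gamma>\<^esub> inv\<^bsub>\<Gamma>\<^esub> \<gamma>)"
      using map[of "inv\<^bsub>\<Gamma>\<^esub> \<gamma>"] \<gamma> by simp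
  qed
  also have "\<dots> = (\<integral>\<^sup>+y. ?d y \<partial>count_space (carrier \<Gamma>))"
  proof (rule nn_integral_bij_count_space)
    show "bij_betw (\<lambda>\<gamma>. ?s \<otimes>\<^bsub>\<Gamma>\<^esub> inv\<^bsub>\<Gamma>\<^esub> \<gamma>) (carrier \<Gamma>) (carrier \<Gamma>)"
    proof (rule bij_betwI[where g = "\<lambda>y. inv\<^bsub>\<Gamma>\<^esub> y \<otimes>\<^bsub>\<Gamma>\<^esub> ?s"])
      show "inv\<^bsub>\<Gamma>\<^esub> (?s \<otimes>\<^bsub>\<Gamma>\<^esub> inv\<^bsub>\<Gamma>\<^esub> \<gamma>) \<otimes>\<^bsub>\<Gamma>\<^esub> ?s = \<gamma>" if "\<gamma> \<in> carrier \<Gamma>" for \<gamma>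
        using that carr by (simp add: \<Gamma>.inv_mult_group \<Gamma>.m_assoc)
      show "?s \<otimes>\<^bsub>\<Gamma>\<^esub> inv\<^bsub>\<Gamma>\<^esub> (inv\<^bsub>\<Gamma>\<^esub> y \<otimes>\<^bsub>\<Gamma>\<^esub> ?s) = y" if "y \<in> carrier \<Gamma>" for y
        using that carr by (simp add: \<Gamma>.inv_mult_group flip: \<Gamma>.m_assoc)
    qed (use carr in auto)
  qed
  finally show ?thesis
    by (simp add: Let_def da dc dt sct)
qed

end

section \<open>Amenability of the centralizer\<close>

context ME_coupling_with_domain
begin

lemma displacement_fibre_sets:
  assumes g: "g \<in> carrier G" and S: "S \<subseteq> carrier \<Gamma>"
  shows "{x \<in> D. displacement g x \<notin> S} \<in> sets M"
proof -
  have "{x \<in> D. displacement g x \<notin> S} = D - (displacement g -` S \<inter> space M)"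
    using D_space by auto
  then show ?thesis
    using D_sets measurable_sets[OF measurable_displacement[OF g], of S] S by auto
qed

text \<open>
  The displacement under \<open>g\<close> is \<open>\<Gamma>\<close>-invariant, so how often it leaves \<open>S\<close> can be measured on \<open>k D\<close> as well
  as on \<open>D\<close>. Consequently \<open>S\<close> can be chosen before \<open>k\<close> is known.
\<close>

lemma emeasure_displaced_fibre:
  assumes g: "g \<in> carrier G" and k: "k \<in> carrier G" and S: "S \<subseteq> carrier \<Gamma>"
  shows "emeasure M {x \<in> D. displacement g (actG k x) \<notin> S} = emeasure M {x \<in> D. displacement g x \<notin> S}"
    and "{x \<in> D. displacement g (actG k x) \<notin> S} \<in> sets M"
proof -
  have D_parts: "disjoint_family_on (\<lambda>\<gamma>. act\<Gamma> \<gamma> ` D) (carrier \<Gamma>)"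
      "(\<Union>\<gamma>\<in>carrier \<Gamma>. act\<Gamma> \<gamma> ` D) = space M"
    using D by (auto simp: fundamental_domain_def)
  define B where "B = {x \<in> space M. displacement g x \<notin> S}"
  have B_sets: "B \<in> sets M"
  proof -
    have "B = space M - (displacement g -` S \<inter> space M)" by (auto simp: B_def)
    then show ?thesis
      using measurable_sets[OF measurable_displacement[OF g], of S] S by auto
  qed
  have B_inv: "act\<Gamma> \<gamma> ` B = B" if "\<gamma> \<in> carrier \<Gamma>" for \<gamma>
    using that act\<Gamma>.act_closed[OF that]
    by (intro act\<Gamma>.image_eq_self) (auto simp: B_def displacement_invariant g)
  have eq: "{x \<in> D. displacement g (actG k x) \<notin> S} = D \<inter> (actG k -` B \<inter> space M)"
    using D_space actG.act_closed[OF k] by (auto simp: B_def)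
  show sets: "{x \<in> D. displacement g (actG k x) \<notin> S} \<in> sets M"
    unfolding eq using D_sets measurable_sets[OF actG.measurable_action[OF k] B_sets] by auto
  have image: "actG k ` (D \<inter> (actG k -` B \<inter> space M)) = actG k ` D \<inter> B"
    using D_space by auto
  have "emeasure M {x \<in> D. displacement g (actG k x) \<notin> S} = emeasure M (actG k ` D \<inter> B)"
    using actG.emeasure_image[OF k sets] unfolding eq image by simp
  also have "\<dots> = emeasure M (D \<inter> B)"
    using emeasure_of_translated_domain[OF \<Gamma>.subgroup_self k D_sets D_parts B_sets B_inv] .
  also have "D \<inter> B = {x \<in> D. displacement g x \<notin> S}"
    using D_space by (auto simp: B_def)
  finally show "emeasure M {x \<in> D. displacement g (actG k x) \<notin> S} = emeasure M {x \<in> D. displacement g x \<notin> S}" .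
qed

text \<open>
  The contrapositive of recurrence: a point of \<open>D\<close> whose displacement under \<open>k\<close> lies in \<open>N\<close> is moved by
  \<open>k\<close> into the union of the translates of \<open>D\<close> by \<open>N\<close>.
\<close>

lemma nonrecurrent_element:
  assumes H: "subgroup H G"
    and sub: "\<And>\<Lambda>. \<Lambda> \<in> \<G> \<Longrightarrow> subgroup \<Lambda> \<Gamma>"
    and not_embeds: "\<not> (\<exists>\<Lambda>\<in>\<G>. measurably_embeds G M \<phi> H \<Lambda>)"
    and small: "small_relative \<Gamma> \<G> N" "N \<subseteq> carrier \<Gamma>" and "0 < \<eta>"
  obtains k where "k \<in> H" "emeasure M {x \<in> D. displacement k x \<in> N} < ennreal \<eta>"
    "{x \<in> D. displacement k x \<in> N} \<in> sets M"
proof -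
  obtain F where F: "finite F" "F \<subseteq> carrier \<Gamma> \<times> \<G> \<times> carrier \<Gamma>"
    and N: "N \<subseteq> (\<Union>(s, \<Lambda>, t)\<in>F. s <#\<^bsub>\<Gamma>\<^esub> \<Lambda> #>\<^bsub>\<Gamma>\<^esub> t)"
    using small(1) unfolding small_relative_def by blast
  define E where "E = (\<Union>(s, \<Lambda>, t)\<in>F. s <#\<^bsub>\<Gamma>\<^esub> \<Lambda> #>\<^bsub>\<Gamma>\<^esub> t)"
  have E_sub: "E \<subseteq> carrier \<Gamma>"
  proof -
    have "s <#\<^bsub>\<Gamma>\<^esub> \<Lambda> #>\<^bsub>\<Gamma>\<^esub> t \<subseteq> carrier \<Gamma>" if "(s, \<Lambda>, t) \<in> F" for s \<Lambda> t
      using that F(2) subgroup.subset[OF sub, of \<Lambda>]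
      by (intro \<Gamma>.r_coset_subset_G \<Gamma>.l_coset_subset_G) auto
    then show ?thesis by (auto simp: E_def)
  qed
  obtain k where k: "k \<in> H" and lt: "measure M (actG k ` D \<inter> (\<Union>\<gamma>\<in>E. act\<Gamma> \<gamma> ` D)) < \<eta>"
    using embeds_of_recurrence[OF D D_fin H sub F \<open>0 < \<eta>\<close>] not_embeds
    unfolding E_def by (meson not_le)
  have kG: "k \<in> carrier G" using k H subgroup.mem_carrier by metis
  let ?A = "{x \<in> D. displacement k x \<in> N}" and ?R = "actG k ` D \<inter> (\<Union>\<gamma>\<in>E. act\<Gamma> \<gamma> ` D)"
  have A_sets: "?A \<in> sets M"
  proof -
    have "?A = D \<inter> (displacement k -` N \<inter> space M)" using D_space by auto
    then show ?thesis
      using D_sets measurable_sets[OF measurable_displacement[OF kG], of N] small(2) by auto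
  qed
  have R_sets: "?R \<in> sets M"
    using D_sets actG.sets_image[OF kG] E_sub countable_subset[OF E_sub countable_\<Gamma>]
    by (intro sets.Int sets.countable_UN'' act\<Gamma>.sets_image) auto
  have "actG k ` ?A \<subseteq> ?R"
  proof
    fix y assume "y \<in> actG k ` ?A"
    then obtain x where x: "x \<in> D" "displacement k x \<in> N" "y = actG k x" by blast
    have y: "y \<in> space M" using x D_space actG.act_closed[OF kG] by auto
    define \<gamma> where "\<gamma> = \<pi> y"
    have \<gamma>: "\<gamma> \<in> carrier \<Gamma>" using measurable_space[OF \<pi> y] by (simp add: \<gamma>_def)
    have "displacement k x = \<gamma>"
      using x \<pi>_one_iff[of x] D_space \<gamma> by (auto simp: displacement_def \<gamma>_def)
    then have "\<gamma> \<in> E" using x(2) N unfolding E_def by blast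
    have z: "act\<Gamma> (inv\<^bsub>\<Gamma>\<^esub> \<gamma>) y \<in> space M" using \<gamma> y by (intro act\<Gamma>.act_closed) auto
    have "\<pi> (act\<Gamma> (inv\<^bsub>\<Gamma>\<^esub> \<gamma>) y) = \<one>\<^bsub>\<Gamma>\<^esub>"
      using \<pi>_act[of "inv\<^bsub>\<Gamma>\<^esub> \<gamma>" y] \<gamma> y by (simp add: \<gamma>_def)
    then have "act\<Gamma> (inv\<^bsub>\<Gamma>\<^esub> \<gamma>) y \<in> D" using \<pi>_one_iff[OF z] by simp
    then have "y \<in> act\<Gamma> \<gamma> ` D"
      using act\<Gamma>.mem_image_iff[OF \<gamma> D_space y] by simp
    then show "y \<in> ?R" using x \<open>\<gamma> \<in> E\<close> by blast
  qed
  then have "emeasure M (actG k ` ?A) \<le> emeasure M ?R"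
    using R_sets by (rule emeasure_mono)
  also have "\<dots> < ennreal \<eta>"
  proof -
    have "emeasure M ?R \<le> emeasure M (actG k ` D)"
      using actG.sets_image[OF kG D_sets] by (intro emeasure_mono) auto
    also have "\<dots> < \<infinity>" using actG.emeasure_image[OF kG D_sets] D_fin by simp
    finally have "emeasure M ?R = ennreal (measure M ?R)"
      by (intro emeasure_eq_ennreal_measure) auto
    then show ?thesis using lt by (simp add: ennreal_lessI \<open>0 < \<eta>\<close>)
  qed
  finally show ?thesis
    using that[OF k] A_sets unfolding actG.emeasure_image[OF kG A_sets] by blast
qed

text \<open>
  The quantifiers are resolved in this order: given a finite subset \<open>F\<close> of the centralizer and \<open>\<epsilon>\<close>, the
  displacements under \<open>F\<close> have finitely many values \<open>S\<close> off a small set; bi-exactness for the finitely many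
  pairs from \<open>S\<close> gives a small subset \<open>N\<close> of \<open>\<Gamma>\<close>; then \<open>k\<close> in \<open>H\<close> is chosen so that its displacement
  rarely lies in \<open>N\<close>. The density transported by this \<open>k\<close> is almost invariant under \<open>F\<close>. Since \<open>G\<close> has a
  fundamental domain, \<open>\<Sigma>\<close> maps equivariantly to the centralizer, and densities on \<open>\<Sigma>\<close> detect its
  amenability.
\<close>

lemma amenable_centralizer:
  assumes H: "subgroup H G"
    and sub: "\<And>\<Lambda>. \<Lambda> \<in> \<G> \<Longrightarrow> subgroup \<Lambda> \<Gamma>"
    and bi_exact: "bi_exact_relative \<Gamma> \<G>"
    and not_embeds: "\<not> (\<exists>\<Lambda>\<in>\<G>. measurably_embeds G M \<phi> H \<Lambda>)"
  shows "amenable (G\<lparr>carrier := centralizer G H\<rparr>)"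
proof -
  have Z: "subgroup (centralizer G H) G"
    by (rule G.subgroup_centralizer[OF subgroup.subset[OF H]])
  have H_sub: "H \<subseteq> carrier G" by (rule subgroup.subset[OF H])
  obtain E where E: "fundamental_domain M (carrier G) actG (space M) E"
    using finite_domain_G by blast
  obtain q where q: "q \<in> measurable M (count_space (centralizer G H))"
    and q_mult: "\<And>z x. z \<in> centralizer G H \<Longrightarrow> x \<in> space M \<Longrightarrow> q (actG z x) = z \<otimes>\<^bsub>G\<^esub> q x"
    using actG.equivariant_map_to_subgroup[OF countable_G E Z] by blast
  obtain \<mu> where \<mu>: "\<forall>x \<in> carrier \<Gamma>. set_pmf (\<mu> x) \<subseteq> carrier \<Gamma>"
    and bi: "\<And>e s t. 0 < e \<Longrightarrow> s \<in> carrier \<Gamma> \<Longrightarrow> t \<in> carrier \<Gamma> \<Longrightarrow>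
      \<exists>N \<subseteq> carrier \<Gamma>. small_relative \<Gamma> \<G> N \<and> (\<forall>x \<in> carrier \<Gamma> - N.
        infsum (\<lambda>y. \<bar>pmf (\<mu> (s \<otimes>\<^bsub>\<Gamma>\<^esub> x \<otimes>\<^bsub>\<Gamma>\<^esub> t)) y - pmf (map_pmf (\<lambda>z. s \<otimes>\<^bsub>\<Gamma>\<^esub> z) (\<mu> x)) y\<bar>) (carrier \<Gamma>) < e)"
    using bi_exact unfolding bi_exact_relative_def by blast
  define c where "c = measure M D"
  have D_c: "emeasure M D = ennreal c"
    unfolding c_def using D_fin by (intro emeasure_eq_ennreal_measure) auto
  have "0 < c"
    using emeasure_domain_pos[OF D] unfolding D_c by (simp add: ennreal_eq_0_iff not_le)
  interpret Z: measure_preserving_action "G\<lparr>carrier := centralizer G H\<rparr>" M actG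
    by (rule action_of_subgroup_G[OF Z])
  show ?thesis
  proof (rule Z.amenable_of_almost_invariant_densities[where q = q and c = c])
    show "q \<in> measurable M (count_space (carrier (G\<lparr>carrier := centralizer G H\<rparr>)))"
      using q by simp
    show "q (actG z x) = z \<otimes>\<^bsub>G\<lparr>carrier := centralizer G H\<rparr>\<^esub> q x"
      if "z \<in> carrier (G\<lparr>carrier := centralizer G H\<rparr>)" "x \<in> space M" for z x
      using that q_mult by simp
    show "0 < c" by fact
    fix F and \<epsilon> :: real
    assume F: "finite F" "F \<subseteq> carrier (G\<lparr>carrier := centralizer G H\<rparr>)" and "0 < \<epsilon>"
    have F_G: "g \<in> carrier G" and F_commute: "\<And>h. h \<in> H \<Longrightarrow> g \<otimes>\<^bsub>G\<^esub> h = h \<otimes>\<^bsub>G\<^esub> g" if "g \<in> F" for g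
      using that F(2) by (auto simp: centralizer_def)
    \<comment> \<open>The error is at most e on D and at most 2 on three exceptional sets of measure \<eta>, and
       e c + 2 (3 \<eta>) = \<epsilon>.\<close>
    define \<eta> where "\<eta> = \<epsilon> / 12"
    define e where "e = \<epsilon> / (2 * c)"
    have "0 < \<eta>" "0 < e" using \<open>0 < \<epsilon>\<close> \<open>0 < c\<close> by (auto simp: \<eta>_def e_def)
    have "\<forall>g\<in>F. \<exists>S. finite S \<and> S \<subseteq> carrier \<Gamma> \<and> emeasure M {x \<in> D. displacement g x \<notin> S} < ennreal \<eta>"
      using finite_values_outside_small_set[OF countable_\<Gamma> measurable_displacement[OF F_G] D_sets D_fin \<open>0 < \<eta>\<close>]
      by metis
    from bchoice[OF this] obtain S0 where S0: "\<And>g. g \<in> F \<Longrightarrow> finite (S0 g)" "\<And>g. g \<in> F \<Longrightarrow> S0 g \<subseteq> carrier \<Gamma>"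
      "\<And>g. g \<in> F \<Longrightarrow> emeasure M {x \<in> D. displacement g x \<notin> S0 g} < ennreal \<eta>"
      by blast
    define S where "S = (\<Union>g\<in>F. S0 g)"
    have S: "finite S" "S \<subseteq> carrier \<Gamma>" using S0 F(1) by (auto simp: S_def)
    define near where "near s t x \<longleftrightarrow> infsum (\<lambda>y. \<bar>pmf (\<mu> (s \<otimes>\<^bsub>\<Gamma>\<^esub> x \<otimes>\<^bsub>\<Gamma>\<^esub> t)) y
      - pmf (map_pmf (\<lambda>z. s \<otimes>\<^bsub>\<Gamma>\<^esub> z) (\<mu> x)) y\<bar>) (carrier \<Gamma>) < e" for s t x
    have "\<exists>N \<subseteq> carrier \<Gamma>. small_relative \<Gamma> \<G> N \<and> (\<forall>x \<in> carrier \<Gamma> - N. near (inv\<^bsub>\<Gamma>\<^esub> fst p) (snd p) x)"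
      if "p \<in> S \<times> S" for p
    proof -
      have "inv\<^bsub>\<Gamma>\<^esub> fst p \<in> carrier \<Gamma>" "snd p \<in> carrier \<Gamma>"
        using S(2) that by auto
      from bi[OF \<open>0 < e\<close> this] show ?thesis unfolding near_def .
    qed
    then obtain N0 where N0: "\<And>p. p \<in> S \<times> S \<Longrightarrow> N0 p \<subseteq> carrier \<Gamma>" "\<And>p. p \<in> S \<times> S \<Longrightarrow> small_relative \<Gamma> \<G> (N0 p)"
      and close: "\<And>p x. p \<in> S \<times> S \<Longrightarrow> x \<in> carrier \<Gamma> - N0 p \<Longrightarrow> near (inv\<^bsub>\<Gamma>\<^esub> fst p) (snd p) x"
      by metis
    define N where "N = (\<Union>p\<in>S \<times> S. N0 p)"
    have N: "small_relative \<Gamma> \<G> N" "N \<subseteq> carrier \<Gamma>"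
      unfolding N_def using S(1) N0 by (auto intro!: \<Gamma>.small_relative_finite_UN)
    obtain k where k: "k \<in> H" and k_small: "emeasure M {x \<in> D. displacement k x \<in> N} < ennreal \<eta>"
      and k_sets: "{x \<in> D. displacement k x \<in> N} \<in> sets M"
      using nonrecurrent_element[OF H sub not_embeds N \<open>0 < \<eta>\<close>] by blast
    have kG: "k \<in> carrier G" using k H_sub by blast
    define f where "f = transported_density \<mu> k"
    have f [measurable]: "f \<in> borel_measurable M"
      unfolding f_def by (rule measurable_transported_density[OF kG])
    have "(\<integral>\<^sup>+x. ennreal \<bar>f (actG g x) - f x\<bar> \<partial>M) \<le> ennreal \<epsilon>" if g: "g \<in> F" for g
    proof -
      note gG = F_G[OF g]
      note [measurable] = D_sets
      \<comment> \<open>Off A and B the two translating elements come from the finite set S; off C the argument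
         of \<mu> avoids the small set N.\<close>
      define A where "A = {x \<in> D. displacement g x \<notin> S}"
      define B where "B = {x \<in> D. displacement g (actG k x) \<notin> S}"
      define C where "C = {x \<in> D. displacement k x \<in> N}"
      note fibre = emeasure_displaced_fibre[OF gG kG S(2)]
      have sets [measurable]: "A \<in> sets M" "B \<in> sets M" "C \<in> sets M"
        using fibre(2) k_sets displacement_fibre_sets[OF gG S(2)] by (auto simp: A_def B_def C_def)
      have A_small: "emeasure M A \<le> ennreal \<eta>"
      proof -
        have "emeasure M A \<le> emeasure M {x \<in> D. displacement g x \<notin> S0 g}"
          unfolding A_def using g
          by (intro emeasure_mono displacement_fibre_sets[OF gG S0(2)[OF g]]) (auto simp: S_def)
        also have "\<dots> \<le> ennreal \<eta>" using S0(3)[OF g] by (rule less_imp_le)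
        finally show ?thesis .
      qed
      then have B_small: "emeasure M B \<le> ennreal \<eta>"
        unfolding A_def B_def fibre(1) .
      have C_small: "emeasure M C \<le> ennreal \<eta>" using k_small by (simp add: C_def)
      have "emeasure M (A \<union> B \<union> C) \<le> emeasure M A + emeasure M B + emeasure M C"
        using emeasure_subadditive[of "A \<union> B" M C] emeasure_subadditive[of A M B] sets
        by (meson add_right_mono order_trans sets.Un)
      also have "\<dots> \<le> ennreal \<eta> + ennreal \<eta> + ennreal \<eta>"
        by (intro add_mono A_small B_small C_small)
      finally have bad: "emeasure M (A \<union> B \<union> C) \<le> ennreal (3 * \<eta>)"
        using \<open>0 < \<eta>\<close> by (simp flip: ennreal_plus)
      have "(\<integral>\<^sup>+x. ennreal \<bar>f (actG g x) - f x\<bar> \<partial>M)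
          = (\<integral>\<^sup>+x. (\<integral>\<^sup>+\<gamma>. ennreal \<bar>f (actG g (act\<Gamma> \<gamma> x)) - f (act\<Gamma> \<gamma> x)\<bar> \<partial>count_space (carrier \<Gamma>)) * indicator D x \<partial>M)"
      proof (rule act\<Gamma>.nn_integral_unfold[OF countable_\<Gamma> D])
        have [measurable]: "(\<lambda>x. f (actG g x)) \<in> borel_measurable M"
          using actG.measurable_action[OF gG] f by (rule measurable_compose)
        show "(\<lambda>x. ennreal \<bar>f (actG g x) - f x\<bar>) \<in> borel_measurable M"
          by measurable
      qed
      also have "\<dots> \<le> (\<integral>\<^sup>+x. ennreal e * indicator D x + 2 * indicator (A \<union> B \<union> C) x \<partial>M)"
      proof (rule nn_integral_mono)
        fix x assume x: "x \<in> space M"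
        show "(\<integral>\<^sup>+\<gamma>. ennreal \<bar>f (actG g (act\<Gamma> \<gamma> x)) - f (act\<Gamma> \<gamma> x)\<bar> \<partial>count_space (carrier \<Gamma>)) * indicator D x
            \<le> ennreal e * indicator D x + 2 * indicator (A \<union> B \<union> C) x"
        proof (cases "x \<in> D")
          case True
          have "\<pi> x = \<one>\<^bsub>\<Gamma>\<^esub>" using \<pi>_one_iff[OF x] True by simp
          note shift = transported_density_shift[OF \<mu> kG gG F_commute[OF g k] x this,
              unfolded Let_def, folded f_def]
          show ?thesis
          proof (cases "x \<in> A \<union> B \<union> C")
            case bad: True
            show ?thesis
              unfolding shift using True bad
              by (simp add: add_increasing nn_integral_pmf_diff_le_2)
          next
            case good: False
            have a: "displacement g x \<in> S" "displacement g (actG k x) \<in> S" "displacement k x \<notin> N"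
              using good True by (auto simp: A_def B_def C_def)
            have "displacement k x \<in> carrier \<Gamma>"
              using measurable_space[OF measurable_displacement[OF kG] x] by simp
            then have "displacement k x \<in> carrier \<Gamma> - N0 (displacement g x, displacement g (actG k x))"
              using a by (auto simp: N_def)
            then show ?thesis
              unfolding shift nn_integral_pmf_diff_eq_infsum
              using True good a close[of "(displacement g x, displacement g (actG k x))" "displacement k x"]
              by (simp add: near_def ennreal_leI)
          qed
        qed simp
      qed
      also have "\<dots> = ennreal e * emeasure M D + 2 * emeasure M (A \<union> B \<union> C)"
        by (simp add: nn_integral_add nn_integral_cmult_indicator)
      also have "\<dots> \<le> ennreal e * ennreal c + 2 * ennreal (3 * \<eta>)"
        unfolding D_c by (intro add_mono mult_left_mono bad) auto
      also have "\<dots> = ennreal (e * c + 2 * (3 * \<eta>))"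
        using \<open>0 < e\<close> \<open>0 < c\<close> \<open>0 < \<eta>\<close> by (simp add: ennreal_mult ennreal_plus)
      also have "e * c + 2 * (3 * \<eta>) = \<epsilon>"
        using \<open>0 < c\<close> by (simp add: e_def \<eta>_def)
      finally show ?thesis .
    qed
    moreover have "(\<integral>\<^sup>+x. ennreal (f x) \<partial>M) = ennreal c"
      unfolding f_def nn_integral_transported_density[OF \<mu> kG] by (rule D_c)
    moreover have "0 \<le> f x" for x by (simp add: f_def transported_density_def)
    ultimately show "\<exists>f. f \<in> borel_measurable M \<and> (\<forall>x. 0 \<le> f x) \<and> (\<integral>\<^sup>+x. ennreal (f x) \<partial>M) = ennreal c \<and>
        (\<forall>g\<in>F. (\<integral>\<^sup>+x. ennreal \<bar>f (actG g x) - f x\<bar> \<partial>M) \<le> ennreal \<epsilon>)"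
      using f by blast
  qed
qed

end

theorem theorem3:
  fixes G :: "('g, 'm) monoid_scheme" and \<Gamma> :: "('c, 'n) monoid_scheme"
    and M :: "'x measure" and \<phi> :: "'g \<times> 'c \<Rightarrow> 'x \<Rightarrow> 'x"
    and \<G> :: "'c set set" and H :: "'g set"
  assumes "group G" and "countable (carrier G)"
    and "group \<Gamma>" and "countable (carrier \<Gamma>)"
    and "ergodic_ME_coupling G \<Gamma> M \<phi>"
    and "\<forall>\<Lambda> \<in> \<G>. subgroup \<Lambda> \<Gamma>"
    and "bi_exact_relative \<Gamma> \<G>"
    and "subgroup H G"
    and "\<not> amenable (G\<lparr>carrier := centralizer G H\<rparr>)"
  shows "\<exists>\<Lambda> \<in> \<G>. measurably_embeds G M \<phi> H \<Lambda>"
proof -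
  have "ME_coupling G \<Gamma> M \<phi>"
    using assms(5) by (rule ergodic_ME_coupling.axioms(1))
  then interpret countable_ME_coupling G \<Gamma> M \<phi>
    using assms(1-4) by (simp add: countable_ME_coupling_def countable_ME_coupling_axioms_def)
  obtain D where D: "fundamental_domain M (carrier \<Gamma>) act\<Gamma> (space M) D" and D_fin: "emeasure M D < \<infinity>"
    using finite_domain_\<Gamma> by blast
  obtain \<pi> where \<pi>: "\<pi> \<in> measurable M (count_space (carrier \<Gamma>))"
    "\<And>\<gamma> x. \<gamma> \<in> carrier \<Gamma> \<Longrightarrow> x \<in> space M \<Longrightarrow> \<pi> (act\<Gamma> \<gamma> x) = \<gamma> \<otimes>\<^bsub>\<Gamma>\<^esub> \<pi> x"
    "\<And>x. x \<in> space M \<Longrightarrow> \<pi> x = \<one>\<^bsub>\<Gamma>\<^esub> \<longleftrightarrow> x \<in> D"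
    using act\<Gamma>.equivariant_map_of_fundamental_domain[OF countable_\<Gamma> D] by blast
  interpret ME_coupling_with_domain G \<Gamma> M \<phi> D \<pi>
    by unfold_locales (use D D_fin \<pi> in auto)
  show ?thesis
    using amenable_centralizer[of H \<G>] assms(6-9) by blast
qed

end
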